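(* Let $p$ be a prime, and let $r\ge 1$ be an integer. There exist partitions $\lambda$ and $\mu$ (of the same integer) such that, for every positive integer $a$: if $a>r$ then $N(\lambda)$ commutes with $N(\mu)$ over the field $\mathbf{F}_{p^{a}}$, and if $a\le r$ then $N(\lambda)$ does not commute with $N(\mu)$ over $\mathbf{F}_{p^a}$.
   Context: A partition of $n$ is a weakly decreasing finite sequence of positive integers (its parts) with sum $n$. For a partition $\lambda$ of $n$ and a field $K$, $N(\lambda)$ denotes the similarity class of nilpotent matrices in $\mathrm{Mat}_n(K)$ whose Jordan block sizes are the parts of $\lambda$. $N(\lambda)$ and $N(\mu)$ commute over $K$ if there exist commuting matrices $X\in N(\lambda)$ and $Y\in N(\mu)$ with entries in $K$. *)

theory Defs
  imports "HOL-Computational_Algebra.Computational_Algebra"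
    "Jordan_Normal_Form.Jordan_Normal_Form"
begin

definition partition_of :: "nat \<Rightarrow> nat list \<Rightarrow> bool" where
  "partition_of n l \<longleftrightarrow> sorted_wrt (\<ge>) l \<and> (\<forall>k\<in>set l. 0 < k) \<and> sum_list l = n"

text \<open>
  A field \<open>K\<close> is represented by its carrier, a subfield of a field type \<open>'a\<close>. Both the matrices
  and the base change (with its inverse) that gives the similarity have entries in \<open>K\<close>.
\<close>

definition mats_over :: "'a set \<Rightarrow> nat \<Rightarrow> 'a mat set" where
  "mats_over K n = {A \<in> carrier_mat n n. elements_mat A \<subseteq> K}"

definition similar_over :: "'a::field set \<Rightarrow> nat \<Rightarrow> 'a mat \<Rightarrow> 'a mat \<Rightarrow> bool" where
  "similar_over K n A B \<longleftrightarrow> (\<exists>P\<in>mats_over K n. \<exists>Q\<in>mats_over K n. similar_mat_wit A B P Q)"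

definition nilp_class :: "'a::field set \<Rightarrow> nat list \<Rightarrow> 'a mat set" where
  "nilp_class K l = {A \<in> mats_over K (sum_list l).
     similar_over K (sum_list l) A (jordan_matrix (map (\<lambda>k. (k, 0)) l))}"

definition nilp_classes_commute :: "'a::field set \<Rightarrow> nat list \<Rightarrow> nat list \<Rightarrow> bool" where
  "nilp_classes_commute K l m \<longleftrightarrow> (\<exists>X\<in>nilp_class K l. \<exists>Y\<in>nilp_class K m. X * Y = Y * X)"

text \<open>
  The field with \<open>p ^ a\<close> elements, inside an algebraically closed field of prime characteristic
  \<open>p\<close>. The lemmas below show that, for \<open>a \<ge> 1\<close>, it is the only subfield with \<open>p ^ a\<close> elements.
\<close>

definition gal_field :: "nat \<Rightarrow> 'a::alg_closed_field set" where
  "gal_field a = {x. x ^ (CHAR('a) ^ a) = x}"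

definition is_subfield :: "'a::field set \<Rightarrow> bool" where
  "is_subfield K \<longleftrightarrow> 0 \<in> K \<and> 1 \<in> K \<and> (\<forall>x\<in>K. \<forall>y\<in>K. x + y \<in> K \<and> x * y \<in> K) \<and>
     (\<forall>x\<in>K. - x \<in> K \<and> inverse x \<in> K)"

lemma is_subfield_gal_field:
  assumes "prime CHAR('a::alg_closed_field)"
  shows "is_subfield (gal_field a :: 'a set)"
proof -
  let ?q = "CHAR('a) ^ a"
  have add: "(x + y) ^ ?q = x ^ ?q + y ^ ?q" for x y :: 'a
    using freshmans_dream'[OF assms, of ?q a] by simp
  have q0: "0 < ?q"
    using assms by (simp add: prime_gt_0_nat)
  have "(- x) ^ ?q = - (x ^ ?q)" for x :: 'a
  proof -
    have "x ^ ?q + (- x) ^ ?q = (x + - x) ^ ?q"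
      by (rule add[symmetric])
    also have "\<dots> = 0"
      using zero_power[OF q0] by (simp only: add.right_inverse)
    finally show ?thesis
      by (metis minus_unique)
  qed
  then show ?thesis
    using add q0 by (auto simp: is_subfield_def gal_field_def power_mult_distrib power_inverse)
qed

lemma card_gal_field:
  assumes "prime CHAR('a::alg_closed_field)" "a \<ge> 1"
  shows "card (gal_field a :: 'a set) = CHAR('a) ^ a"
proof -
  let ?q = "CHAR('a) ^ a"
  define f :: "'a poly" where "f = monom 1 ?q - monom 1 1"
  have "1 < CHAR('a)"
    using assms(1) by (rule prime_gt_1_nat)
  then have q1: "1 < ?q"
    using assms(2) by (intro one_less_power) auto
  have deg: "degree f = ?q"
    unfolding f_def diff_conv_add_uminus using q1
    by (subst degree_add_eq_left) (simp_all add: degree_monom_eq)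
  have f0: "f \<noteq> 0"
    using deg q1 by (metis degree_0 not_less_zero)
  have "of_nat ?q = (0 :: 'a)"
    using assms(2) by (simp add: of_nat_eq_0_iff_char_dvd)
  then have "pderiv f = - 1"
    using assms(2) by (simp add: f_def pderiv_diff pderiv_monom monom_0 one_pCons power_0_left)
  then have simple: "poly (pderiv f) x \<noteq> 0" for x
    by simp
  have ord: "order x f = 1" if "poly f x = 0" for x
  proof (rule ccontr)
    assume "order x f \<noteq> 1"
    moreover have "order x f \<noteq> 0"
      using f0 that by (simp add: order_root)
    ultimately have "[:- x, 1:] ^ 2 dvd f"
      by (simp add: order_divides)
    then obtain g where "f = [:- x, 1:] ^ 2 * g" ..
    then have "poly (pderiv f) x = 0"
      by (simp only: power2_eq_square pderiv_mult poly_add poly_mult) simp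
    then show False
      using simple by blast
  qed
  obtain A where A: "size A = degree f" "f = Polynomial.smult (lead_coeff f) (\<Prod>x\<in>#A. [:- x, 1:])"
    using alg_closed_imp_factorization[OF f0] by blast
  have "proots (\<Prod>x\<in>#A. [:- x, 1:]) = A"
    by (induction A) (simp_all add: proots_mult prod_mset_zero_iff image_iff del: mult_pCons_left)
  then have "proots f = A"
    using f0 by (subst A(2)) simp
  then have "?q = size (proots f)"
    using A(1) deg by simp
  also have "\<dots> = (\<Sum>x | poly f x = 0. order x f)"
    using f0 by (simp add: size_multiset_overloaded_eq)
  also have "\<dots> = card {x. poly f x = 0}"
    using ord by simp
  also have "{x. poly f x = 0} = gal_field a"
    by (simp add: f_def gal_field_def poly_monom)
  finally show ?thesis
    by simp
qed

lemma gal_field_unique: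
  fixes K :: "'a::alg_closed_field set"
  assumes "prime CHAR('a)" "a \<ge> 1" "is_subfield K" "card K = CHAR('a) ^ a"
  shows "K = gal_field a"
proof -
  have fin: "finite K"
    using assms(1,4) by (intro card_ge_0_finite) (simp add: prime_gt_0_nat)
  have zero: "0 \<in> K"
    using assms(3) by (simp add: is_subfield_def)
  have "x ^ card K = x" if "x \<in> K" "x \<noteq> 0" for x
  proof -
    let ?U = "K - {0}"
    have "(*) x ` ?U \<subseteq> ?U"
      using assms(3) that by (auto simp: is_subfield_def)
    moreover have inj: "inj_on ((*) x) ?U"
      using that by (auto simp: inj_on_def)
    ultimately have im: "(*) x ` ?U = ?U"
      using fin by (intro endo_inj_surj) auto
    have "\<Prod>?U = \<Prod>((*) x ` ?U)"
      using im by simp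
    also have "\<dots> = (\<Prod>y\<in>?U. x * y)"
      using inj by (simp add: prod.reindex)
    also have "\<dots> = x ^ card ?U * \<Prod>?U"
      by (simp add: prod.distrib)
    finally have "x ^ card ?U = 1"
      using fin by simp
    moreover have "card K = Suc (card ?U)"
      using fin zero by (metis card.remove)
    ultimately show ?thesis
      by simp
  qed
  moreover have "(0::'a) ^ card K = 0"
    using fin zero by (auto simp: power_0_left)
  ultimately have "K \<subseteq> gal_field a"
    using assms(4) by (fastforce simp: gal_field_def)
  moreover have "finite (gal_field a :: 'a set)"
    using card_gal_field[OF assms(1,2)] assms(1)
    by (intro card_ge_0_finite) (simp add: prime_gt_0_nat)
  ultimately show ?thesis
    using card_gal_field[OF assms(1,2)] assms(4) by (simp add: card_subset_eq)
qed

end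

theory Submission
  imports Defs "HOL-Number_Theory.Cong"
begin

text \<open>
  Take \<open>\<lambda> = (k, k)\<close> and \<open>\<mu> = (k + 1, k - 1)\<close> with \<open>k \<ge> 3\<close>. The centraliser of a nilpotent \<open>X\<close> of
  type \<open>(k, k)\<close> consists of the \<open>2 \<times> 2\<close> matrices over \<open>K[x] / x ^ k\<close>, and such a matrix \<open>Y\<close> satisfies
  its characteristic equation \<open>Y\<^sup>2 = \<tau> Y - \<delta>\<close>. If \<open>Y\<close> has type \<open>(k + 1, k - 1)\<close>, then \<open>x\<close> divides
  \<open>\<tau>\<close> and \<open>x\<^sup>2\<close> divides \<open>\<delta>\<close>, with leading coefficients \<open>t\<close> and \<open>d \<noteq> 0\<close>, and
  \<open>Y ^ k = U x ^ (k - 1) Y\<close> where \<open>U\<close> is the \<open>k\<close>-th Lucas number with parameters \<open>(t, d)\<close>.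
  So \<open>U \<noteq> 0\<close>; conversely, any such \<open>t, d \<in> K\<close> yield a suitable \<open>Y\<close>. In other words, the classes
  commute over \<open>K\<close> if and only if the exponent of \<open>PGL(2, K)\<close> does not divide \<open>k\<close>.
  With \<open>k\<close> equal to \<open>p\<close> times the least common multiple of the numbers \<open>p ^ (2 b) - 1\<close> for
  \<open>b \<le> r\<close>, this exponent divides \<open>k\<close> for the field with \<open>p ^ a\<close> elements if \<open>a \<le> r\<close>, and it does not if
  \<open>a > r\<close> by a weak form of Zsigmondy's theorem.
\<close>

subsection \<open>A weak form of Zsigmondy's theorem\<close>

lemma gcd_power_minus_one_dvd:
  fixes q :: nat
  assumes "q \<ge> 1"
  shows "gcd (q ^ a - 1) (q ^ b - 1) dvd q ^ gcd a b - 1"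
proof -
  let ?g = "gcd (q ^ a - 1) (q ^ b - 1)"
  have cong: "[q ^ c = 1] (mod ?g) \<longleftrightarrow> ?g dvd q ^ c - 1" for c
    using assms by (subst cong_altdef_nat) auto
  show ?thesis
  proof (cases "a = 0")
    case False
    then obtain x y where xy: "a * x = b * y + gcd a b"
      using bezout_nat by blast
    have "[(q ^ a) ^ x = 1 ^ x] (mod ?g)" "[(q ^ b) ^ y = 1 ^ y] (mod ?g)"
      using cong[of a] cong[of b] by (intro cong_pow; simp)+
    then have "[q ^ (a * x) = 1] (mod ?g)" "[q ^ (b * y) = 1] (mod ?g)"
      by (simp_all add: power_mult)
    then have "[q ^ (b * y + gcd a b) = 1] (mod ?g)" "[q ^ (b * y) = 1] (mod ?g)"
      by (simp_all only: xy)
    moreover from this(2) have "[q ^ (b * y) * q ^ gcd a b = 1 * q ^ gcd a b] (mod ?g)"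
      by (rule cong_mult[OF _ cong_refl])
    ultimately have "[q ^ gcd a b = 1] (mod ?g)"
      by (simp add: power_add cong_def)
    then show ?thesis
      using cong by blast
  qed simp
qed

lemma norm_poly_ge_of_roots_on_unit_circle:
  fixes f :: "complex poly"
  assumes "degree f \<ge> 1" "norm (lead_coeff f) \<ge> 1"
    and "\<And>z. poly f z = 0 \<Longrightarrow> norm z = 1"
    and "norm x \<ge> 4"
  shows "norm (poly f x) \<ge> 3"
proof -
  have f0: "f \<noteq> 0"
    using assms(1) by auto
  obtain A where A: "size A = degree f" "f = Polynomial.smult (lead_coeff f) (\<Prod>x\<in>#A. [:- x, 1:])"
    using alg_closed_imp_factorization[OF f0] by blast
  define g where "g = (\<lambda>B. norm (poly (\<Prod>x\<in>#B. [:- x, 1:] :: complex poly) x))"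
  have g: "g B \<ge> 3 ^ size B" if "\<And>z. z \<in># B \<Longrightarrow> norm z = 1" for B
    using that
  proof (induction B)
    case empty
    then show ?case
      by (simp add: g_def)
  next
    case (add z B)
    have "norm (x - z) \<ge> norm x - norm z"
      by (rule norm_triangle_ineq2)
    then have "3 \<le> norm (x - z)"
      using add.prems[of z] assms(4) by simp
    moreover have "3 ^ size B \<le> g B"
      using add by simp
    ultimately have "3 * 3 ^ size B \<le> norm (x - z) * g B"
      by (intro mult_mono) auto
    moreover have "g (add_mset z B) = norm (x - z) * g B"
      by (simp add: g_def norm_mult del: mult_pCons_left)
    ultimately show ?case
      by simp
  qed
  have "norm z = 1" if "z \<in># A" for z
  proof -
    have "poly (\<Prod>x\<in>#A. [:- x, 1:]) z = 0"
      using that by (induction A) (auto simp del: mult_pCons_left)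
    then show ?thesis
      using A(2) assms(3) by (metis mult_zero_right poly_smult)
  qed
  then have "3 ^ degree f \<le> g A"
    using g A(1) by metis
  moreover have "(3::real) ^ 1 \<le> 3 ^ degree f"
    using assms(1) by (intro power_increasing) auto
  ultimately have "3 \<le> g A"
    by simp
  also have "\<dots> \<le> norm (lead_coeff f) * g A"
    using assms(2) by (simp add: g_def mult_le_cancel_right1)
  also have "\<dots> = norm (poly f x)"
    by (subst (3) A(2)) (simp add: g_def norm_mult)
  finally show ?thesis .
qed

lemma exists_common_multiple_polynomial:
  fixes D :: "nat set"
  assumes "finite D" "\<And>d. d \<in> D \<Longrightarrow> d dvd a"
  shows "\<exists>G :: int poly. (\<forall>d\<in>D. monom 1 d - 1 dvd G) \<and> G dvd monom 1 a - 1 \<and>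
    (\<forall>z::complex. poly (of_int_poly G) z = 0 \<longrightarrow> (\<exists>d\<in>D. z ^ d = 1))"
  using assms
proof (induction D rule: finite_induct)
  case empty
  then show ?case
    by (intro exI[of _ 1]) simp
next
  case (insert d D)
  then obtain G :: "int poly" where G: "\<forall>d\<in>D. monom 1 d - 1 dvd G" "G dvd monom 1 a - 1"
    "\<And>z::complex. poly (of_int_poly G) z = 0 \<Longrightarrow> \<exists>d\<in>D. z ^ d = 1"
    by auto
  let ?f = "monom 1 d - 1 :: int poly"
  obtain e where e: "a = d * e"
    using insert.prems[of d] by auto
  have "?f dvd (monom 1 d) ^ e - 1"
    by (simp add: power_diff_1_eq)
  then have "?f dvd monom 1 a - 1"
    by (simp add: monom_power e)
  then have "lcm G ?f dvd monom 1 a - 1"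
    using G(2) by simp
  moreover have "\<exists>d'\<in>insert d D. z ^ d' = 1" if "poly (of_int_poly (lcm G ?f)) z = 0" for z :: complex
  proof -
    obtain h where "G * ?f = lcm G ?f * h"
      using lcm_least[of G "G * ?f" ?f] by (metis dvd_def dvd_triv_left dvd_triv_right)
    then have "poly (of_int_poly (G * ?f)) z = 0"
      using that by (simp add: hom_distribs)
    then have "poly (of_int_poly G) z = 0 \<or> z ^ d = 1"
      by (auto simp: hom_distribs poly_monom)
    then show ?thesis
      using G(3) by blast
  qed
  ultimately show ?case
    using G(1) by (intro exI[of _ "lcm G ?f"]) (auto intro: dvd_trans)
qed

text \<open>The cofactor of the least common multiple of the polynomials \<open>x ^ d - 1\<close> (\<open>d\<close> a proper
  divisor of \<open>a\<close>) in \<open>x ^ a - 1\<close> has all its roots on the unit circle, so it is large at \<open>q\<close>.\<close>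

lemma power_minus_one_not_dvd_Lcm:
  fixes q :: nat
  assumes "q \<ge> 4" "r < a"
  shows "\<not> q ^ a - 1 dvd 2 * Lcm ((\<lambda>b. q ^ b - 1) ` {1..r})"
proof
  let ?n = "q ^ a - 1"
  assume n: "?n dvd 2 * Lcm ((\<lambda>b. q ^ b - 1) ` {1..r})"
  define D where "D = {d. d dvd a \<and> d < a}"
  have "finite D"
    by (simp add: D_def)
  moreover have "d dvd a" if "d \<in> D" for d
    using that by (simp add: D_def)
  ultimately obtain G :: "int poly" where G: "\<forall>d\<in>D. monom 1 d - 1 dvd G" "G dvd monom 1 a - 1"
    "\<And>z::complex. poly (of_int_poly G) z = 0 \<Longrightarrow> \<exists>d\<in>D. z ^ d = 1"
    using exists_common_multiple_polynomial[of D a] by blast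
  obtain H where H: "monom 1 a - 1 = G * H"
    using G(2) by blast
  let ?Q = "int q"
  define N where "N = nat \<bar>poly G ?Q\<bar>"
  have a: "a > 0" "q \<ge> 1"
    using assms by auto
  have int_pow: "int (q ^ c - 1) = ?Q ^ c - 1" for c
    using a by (simp add: of_nat_diff)
  have D_dvd: "q ^ d - 1 dvd N" if "d \<in> D" for d
  proof -
    have "poly (monom 1 d - 1) ?Q dvd poly G ?Q"
      using G(1) that by (metis dvd_def poly_mult)
    then have "int (q ^ d - 1) dvd poly G ?Q"
      unfolding int_pow by (simp add: poly_monom)
    then show ?thesis
      unfolding N_def by (subst int_dvd_int_iff[symmetric]) simp
  qed
  have gcd_dvd: "gcd ?n (Lcm ((\<lambda>b. q ^ b - 1) ` B)) dvd N" if "finite B" "B \<subseteq> {1..r}" for B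
    using that
  proof (induction B rule: finite_induct)
    case empty
    then show ?case
      by simp
  next
    case (insert b B)
    have "gcd a b \<in> D"
      using insert.prems assms(2) unfolding D_def
      by (auto intro: le_less_trans[OF gcd_le2_nat])
    moreover have "gcd ?n (q ^ b - 1) dvd q ^ gcd a b - 1"
      using a(2) by (rule gcd_power_minus_one_dvd)
    ultimately have "gcd ?n (q ^ b - 1) dvd N"
      using D_dvd dvd_trans by blast
    then show ?case
      using insert by (simp add: gcd_lcm_distrib)
  qed
  have "?n dvd gcd (2 * ?n) (2 * Lcm ((\<lambda>b. q ^ b - 1) ` {1..r}))"
    using n by simp
  also have "\<dots> = 2 * gcd ?n (Lcm ((\<lambda>b. q ^ b - 1) ` {1..r}))"
    by (simp add: gcd_mult_distrib_nat)
  also have "\<dots> dvd 2 * N"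
    using gcd_dvd[of "{1..r}"] by (intro mult_dvd_mono) auto
  finally have "int ?n dvd int (2 * N)"
    by (rule iffD2[OF int_dvd_int_iff])
  also have "int (2 * N) = \<bar>2 * poly G ?Q\<bar>"
    by (simp add: N_def abs_mult)
  finally have n_dvd: "int ?n dvd 2 * poly G ?Q"
    by (simp only: dvd_abs_iff)
  have nGH: "int ?n = poly G ?Q * poly H ?Q"
    using arg_cong[OF H, of "\<lambda>f. poly f ?Q"] unfolding int_pow by (simp add: poly_monom)
  have n0: "int ?n \<noteq> 0"
  proof -
    have "q ^ 1 \<le> q ^ a"
      using a by (intro power_increasing) auto
    then have "?n \<noteq> 0"
      using assms(1) unfolding power_one_right by linarith
    then show ?thesis
      by (simp only: of_nat_eq_0_iff not_False_eq_True)
  qed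
  have "poly G ?Q * poly H ?Q dvd poly G ?Q * 2"
    using n_dvd by (simp only: nGH mult.commute)
  moreover have "poly G ?Q \<noteq> 0"
    using n0 unfolding nGH by simp
  ultimately have H2: "poly H ?Q dvd 2"
    by simp
  let ?H = "of_int_poly H :: complex poly"
  have GHz: "z ^ a - 1 = poly (of_int_poly G) z * poly ?H z" for z :: complex
    using arg_cong[OF H, of "\<lambda>f. poly (of_int_poly f) z"] by (simp add: hom_distribs poly_monom)
  have H0: "H \<noteq> 0"
    using nGH n0 by (metis mult_zero_right poly_0)
  have "degree H \<ge> 1"
  proof (rule ccontr)
    assume "\<not> degree H \<ge> 1"
    then have "degree H = 0"
      by simp
    then obtain c where c: "H = [:c:]"
      by (rule degree_eq_zeroE)
    let ?z = "cis (2 * pi / a)"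
    have "?z ^ a = 1"
      using a by (simp add: DeMoivre)
    then have "poly (of_int_poly G) ?z = 0"
      using GHz[of ?z] H0 c by simp
    then obtain d where d: "d \<in> D" "?z ^ d = 1"
      using G(3) by blast
    then have "d > 0" "d < a"
      using a by (auto simp: D_def intro: Nat.gr0I)
    have "cis (2 * pi * d / a) = cis 0"
      using d(2) by (simp add: DeMoivre mult_ac)
    then have "cos (2 * pi * d / a) = 1"
      by (simp add: complex_eq_iff)
    then obtain j :: int where j: "2 * pi * d / a = j * 2 * pi"
      using cos_one_2pi_int by auto
    then have "real d = j * a"
      using a by (simp add: field_simps)
    then have "int d = j * int a"
      by (metis of_int_eq_iff of_int_mult of_int_of_nat_eq)
    then show False
      using \<open>d > 0\<close> \<open>d < a\<close> by (metis dvd_triv_right int_dvd_int_iff nat_dvd_not_less)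
  qed
  moreover have "norm (lead_coeff ?H) \<ge> 1"
  proof -
    have "lead_coeff H \<noteq> 0"
      using H0 by simp
    then have "\<bar>lead_coeff H\<bar> \<ge> 1"
      by linarith
    then show ?thesis
      by (simp flip: of_int_abs)
  qed
  moreover have "norm z = 1" if "poly ?H z = 0" for z
  proof -
    have "z ^ a = 1"
      using GHz[of z] that by simp
    then have "norm z ^ a = 1 ^ a"
      by (simp flip: norm_power)
    then show ?thesis
      using a by (intro power_eq_imp_eq_base[of "norm z" a 1]) auto
  qed
  ultimately have "norm (poly ?H (of_int ?Q)) \<ge> 3"
    using assms(1) by (intro norm_poly_ge_of_roots_on_unit_circle) auto
  then have "\<bar>poly H ?Q\<bar> \<ge> 3"
    by (simp only: of_int_hom.poly_map_poly norm_of_int)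
  then show False
    using dvd_imp_le_int[OF _ H2] by simp
qed

subsection \<open>Lucas sequences over finite fields\<close>

fun lucas :: "'b::comm_ring_1 \<Rightarrow> 'b \<Rightarrow> nat \<Rightarrow> 'b" where
  "lucas t d 0 = 0"
| "lucas t d (Suc 0) = 1"
| "lucas t d (Suc (Suc n)) = t * lucas t d (Suc n) - d * lucas t d n"

lemma lucas_mult_diff: "lucas (x + y) (x * y) n * (x - y) = x ^ n - y ^ n"
proof (induction n rule: induct_nat_012)
  case (ge2 n)
  have "lucas (x + y) (x * y) (Suc (Suc n)) * (x - y)
      = (x + y) * (lucas (x + y) (x * y) (Suc n) * (x - y)) - x * y * (lucas (x + y) (x * y) n * (x - y))"
    by (simp add: algebra_simps)
  also have "\<dots> = x ^ Suc (Suc n) - y ^ Suc (Suc n)"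
    unfolding ge2 by (simp add: algebra_simps)
  finally show ?case .
qed auto

lemma lucas_double_root: "lucas (x + x) (x * x) (Suc n) = of_nat (Suc n) * x ^ n"
proof (induction n rule: induct_nat_012)
  case (ge2 n)
  have "lucas (x + x) (x * x) (Suc (Suc (Suc n)))
      = (x + x) * lucas (x + x) (x * x) (Suc (Suc n)) - x * x * lucas (x + x) (x * x) (Suc n)"
    by simp
  also have "\<dots> = of_nat (Suc (Suc (Suc n))) * x ^ Suc (Suc n)"
    unfolding ge2 by (simp add: algebra_simps)
  finally show ?case .
qed auto

lemma exists_quadratic_roots:
  fixes t d :: "'a::alg_closed_field"
  shows "\<exists>x y. t = x + y \<and> d = x * y"
proof -
  have "degree [:d, - t, 1:] > 0"
    by simp
  then obtain x where "poly [:d, - t, 1:] x = 0"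
    using alg_closed_imp_poly_has_root by blast
  then have "d = x * (t - x)"
    by (simp add: algebra_simps)
  then show ?thesis
    by (intro exI[of _ x] exI[of _ "t - x"]) simp
qed

lemma one_less_CHAR_power:
  assumes "prime CHAR('a::semiring_1)" "a \<ge> 1"
  shows "1 < CHAR('a) ^ a"
  using prime_gt_1_nat[OF assms(1)] assms(2) by (intro one_less_power) auto

lemma frobenius_add:
  fixes x y :: "'a::alg_closed_field"
  assumes "prime CHAR('a)"
  shows "(x + y) ^ (CHAR('a) ^ a) = x ^ (CHAR('a) ^ a) + y ^ (CHAR('a) ^ a)"
  using freshmans_dream'[OF assms, of "CHAR('a) ^ a" a] by simp

lemma gal_field_root_of_unity:
  fixes x :: "'a::alg_closed_field"
  assumes "prime CHAR('a)" "x \<in> gal_field a" "x \<noteq> 0"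
  shows "x ^ (CHAR('a) ^ a - 1) = 1"
proof -
  have "CHAR('a) ^ a > 0"
    using assms(1) by (simp add: prime_gt_0_nat)
  then have "x * x ^ (CHAR('a) ^ a - 1) = x ^ (CHAR('a) ^ a)"
    by (metis power_minus_mult mult.commute)
  also have "\<dots> = x * 1"
    using assms(2) by (simp add: gal_field_def)
  finally show ?thesis
    using assms(3) by simp
qed

lemma quadratic_roots_in_gal_field:
  fixes x y :: "'a::alg_closed_field"
  assumes "prime CHAR('a)" "x + y \<in> gal_field a" "x * y \<in> gal_field a"
  shows "x \<in> gal_field (2 * a)"
proof -
  let ?q = "CHAR('a) ^ a"
  have add: "x ^ ?q + y ^ ?q = x + y"
    using assms(2) frobenius_add[OF assms(1), of x y a] by (simp add: gal_field_def)
  have mult: "x ^ ?q * y ^ ?q = x * y"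
    using assms(3) by (simp add: gal_field_def power_mult_distrib)
  have "(x ^ ?q - x) * (x ^ ?q - y) = x ^ ?q * (x ^ ?q - (x + y)) + x * y"
    by (simp add: algebra_simps)
  also have "\<dots> = 0"
    by (simp add: algebra_simps flip: add mult)
  finally have "x ^ ?q = x \<or> x ^ ?q = y"
    by simp
  then have "(x ^ ?q) ^ ?q = x"
    using add by (auto simp: algebra_simps)
  then show ?thesis
    by (simp add: gal_field_def mult_2 power_add power_mult)
qed

lemma lucas_gal_field_eq_0:
  fixes t d :: "'a::alg_closed_field"
  assumes "prime CHAR('a)" "t \<in> gal_field a" "d \<in> gal_field a" "d \<noteq> 0"
    and "CHAR('a) dvd k" "CHAR('a) ^ (2 * a) - 1 dvd k" "k > 0"
  shows "lucas t d k = 0"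
proof -
  obtain x y where xy: "t = x + y" "d = x * y"
    using exists_quadratic_roots by blast
  have "z ^ k = 1" if "z \<in> gal_field (2 * a)" "z \<noteq> 0" for z :: 'a
    using gal_field_root_of_unity[OF assms(1) that] assms(6) by (auto simp: power_mult)
  moreover have "x \<in> gal_field (2 * a)" "y \<in> gal_field (2 * a)"
    using quadratic_roots_in_gal_field[OF assms(1), of x y] quadratic_roots_in_gal_field[OF assms(1), of y x]
      assms(2,3) xy by (simp_all add: add.commute[of y] mult.commute[of y])
  ultimately have "x ^ k = 1" "y ^ k = 1"
    using assms(4) xy by auto
  then have *: "lucas t d k * (x - y) = 0"
    using xy lucas_mult_diff[of x y k] by simp
  show ?thesis
  proof (cases "x = y")
    case True
    have "of_nat k = (0::'a)"
      using assms(5) by (simp add: of_nat_eq_0_iff_char_dvd)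
    then show ?thesis
      using lucas_double_root[of x "k - 1"] assms(7) xy True by simp
  next
    case False
    then show ?thesis
      using * by simp
  qed
qed

lemma gal_field_exponent_dvd:
  assumes "prime CHAR('a::alg_closed_field)" "a \<ge> 1" "k > 0"
    and "\<And>x::'a. x \<in> gal_field a \<Longrightarrow> x \<noteq> 0 \<Longrightarrow> x ^ k = 1"
  shows "CHAR('a) ^ a - 1 dvd k"
proof -
  let ?n = "CHAR('a) ^ a - 1"
  let ?U = "gal_field a - {0 :: 'a}"
  let ?g = "gcd k ?n"
  have n: "?n > 0"
    using one_less_CHAR_power[OF assms(1,2)] by simp
  have card: "card ?U = ?n"
    using card_gal_field[OF assms(1,2)] assms(1)
    by (subst card_Diff_singleton) (auto simp: gal_field_def prime_gt_0_nat)
  define f :: "'a poly" where "f = monom 1 ?g - 1"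
  have g: "?g > 0"
    using assms(3) by simp
  have "coeff f ?g = 1"
    using g by (simp add: f_def)
  then have f0: "f \<noteq> 0"
    by auto
  have "?U \<subseteq> {x. poly f x = 0}"
  proof
    fix x assume x: "x \<in> ?U"
    then have "x ^ k = 1" "x ^ ?n = 1"
      using assms(4) gal_field_root_of_unity[OF assms(1)] by auto
    obtain u v where "k * u = ?n * v + ?g"
      using bezout_nat[of k ?n] assms(3) by auto
    then have "(x ^ k) ^ u = (x ^ ?n) ^ v * x ^ ?g"
      by (simp only: flip: power_mult power_add)
    then have "x ^ ?g = 1"
      by (simp only: \<open>x ^ k = 1\<close> \<open>x ^ ?n = 1\<close>) simp
    then show "x \<in> {x. poly f x = 0}"
      by (simp add: f_def poly_monom)
  qed
  then have "?n \<le> card {x. poly f x = 0}"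
    using card poly_roots_finite[OF f0] by (metis card_mono)
  also have "\<dots> \<le> degree f"
    using f0 by (rule card_poly_roots_bound)
  also have "\<dots> \<le> ?g"
    unfolding f_def by (intro degree_diff_le) (auto simp: degree_monom_le)
  finally have "?g = ?n"
    using n by (metis dvd_imp_le gcd_dvd2 le_antisym)
  then show ?thesis
    by (metis gcd_dvd1)
qed

lemma dvd_of_lucas_gal_field_eq_0:
  assumes "prime CHAR('a::alg_closed_field)" "a \<ge> 1" "k > 0"
    and lucas0: "\<And>t d :: 'a. t \<in> gal_field a \<Longrightarrow> d \<in> gal_field a \<Longrightarrow> d \<noteq> 0 \<Longrightarrow> lucas t d k = 0"
  shows "CHAR('a) ^ (2 * a) - 1 dvd 2 * k"
proof -
  let ?q = "CHAR('a) ^ a"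
  have q1: "?q > 1"
    using assms(1,2) by (rule one_less_CHAR_power)
  obtain s where s: "?q = s + 1" "s > 0"
    using q1 by (intro that[of "?q - 1"]) auto
  have q2: "?q ^ 2 = CHAR('a) ^ (2 * a)"
    by (simp add: mult.commute flip: power_mult)
  have dvd1: "?q - 1 dvd k"
  proof (rule gal_field_exponent_dvd[OF assms(1-3)])
    fix x :: 'a
    assume x: "x \<in> gal_field a" "x \<noteq> 0"
    then have "x + 1 \<in> gal_field a" "x * 1 \<in> gal_field a"
      using frobenius_add[OF assms(1), of x 1 a] by (simp_all add: gal_field_def)
    then have "lucas (x + 1) (x * 1) k = 0"
      using x by (intro lucas0) auto
    then show "x ^ k = 1"
      using lucas_mult_diff[of x 1 k] by simp
  qed
  have dvd2: "CHAR('a) ^ (2 * a) - 1 dvd k * s"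
  proof (rule gal_field_exponent_dvd[OF assms(1)])
      fix x :: 'a
      assume x: "x \<in> gal_field (2 * a)" "x \<noteq> 0"
      let ?y = "x ^ ?q"
      have yq: "?y ^ ?q = x"
        using x(1) by (simp add: gal_field_def mult_2 power_add power_mult)
      have "x + ?y \<in> gal_field a"
        using frobenius_add[OF assms(1), of x ?y a] yq by (simp add: gal_field_def add.commute)
      moreover have "x * ?y \<in> gal_field a"
        by (simp add: gal_field_def power_mult_distrib yq mult.commute del: power_mult)
      ultimately have "lucas (x + ?y) (x * ?y) k = 0"
        using x by (intro lucas0) auto
      then have "x ^ k = ?y ^ k"
        using lucas_mult_diff[of x ?y k] by simp
      also have "\<dots> = x ^ (k + k * s)"
        by (simp add: s(1) algebra_simps power_add flip: power_mult)
      finally show "x ^ (k * s) = 1"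
        using x(2) by (simp add: power_add)
    qed (use assms s in auto)
  have fact: "?q ^ 2 - 1 = s * (s + 2)"
    by (simp add: s power2_eq_square)
  obtain m where m: "k = s * m"
    using dvd1 s by auto
  have "s * (s + 2) dvd s * k"
    using dvd2 by (simp only: fact mult.commute[of s k] flip: q2)
  then have "s + 2 dvd k"
    using s(2) by (simp only: nat_mult_dvd_cancel1)
  then have "s + 2 dvd (s + 2) * m - k"
    by (rule dvd_diff_nat[OF dvd_triv_left])
  also have "(s + 2) * m - k = 2 * m"
    by (simp add: m algebra_simps)
  finally have "s * (s + 2) dvd s * (2 * m)"
    by (rule mult_dvd_mono[OF dvd_refl])
  then show ?thesis
    by (simp only: m mult.left_commute fact flip: q2)
qed

subsection \<open>Matrices over a subfield\<close>

lemma mats_over_iff: "A \<in> mats_over K n \<longleftrightarrow> A \<in> carrier_mat n n \<and> (\<forall>i<n. \<forall>j<n. A $$ (i, j) \<in> K)"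
  unfolding mats_over_def elements_mat_def by (auto simp: UN_subset_iff image_subset_iff)

lemma subfield_sum:
  assumes "is_subfield K" "\<And>i. i \<in> I \<Longrightarrow> f i \<in> K"
  shows "sum f I \<in> K"
  using assms by (induction I rule: infinite_finite_induct) (auto simp: is_subfield_def)

lemma subfield_prod:
  assumes "is_subfield K" "\<And>i. i \<in> I \<Longrightarrow> f i \<in> K"
  shows "prod f I \<in> K"
  using assms by (induction I rule: infinite_finite_induct) (auto simp: is_subfield_def)

lemma subfield_power:
  assumes "is_subfield K" "x \<in> K"
  shows "x ^ n \<in> K"
  using assms by (induction n) (auto simp: is_subfield_def)

lemma subfield_diff:
  assumes "is_subfield K" "x \<in> K" "y \<in> K"
  shows "x - y \<in> K"
  using assms unfolding diff_conv_add_uminus by (simp only: is_subfield_def)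

lemma subfield_lucas:
  assumes "is_subfield K" "t \<in> K" "d \<in> K"
  shows "lucas t d n \<in> K"
proof (induction n rule: induct_nat_012)
  case (ge2 n)
  then show ?case
    using assms subfield_diff[OF assms(1)] by (simp add: is_subfield_def)
qed (use assms in \<open>simp_all add: is_subfield_def\<close>)

lemma mats_over_mult:
  assumes K: "is_subfield K" and "A \<in> mats_over K n" "B \<in> mats_over K n"
  shows "A * B \<in> mats_over K n"
  unfolding mats_over_iff
proof (intro conjI allI impI)
  have A: "A \<in> carrier_mat n n" and B: "B \<in> carrier_mat n n"
    using assms(2,3) by (simp_all add: mats_over_iff)
  then show "A * B \<in> carrier_mat n n"
    by simp
  fix i j assume ij: "i < n" "j < n"
  have "A $$ (i, l) * B $$ (l, j) \<in> K" if "l < n" for l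
    using assms ij that by (simp add: mats_over_iff is_subfield_def)
  then have "(\<Sum>l<n. A $$ (i, l) * B $$ (l, j)) \<in> K"
    by (intro subfield_sum[OF K]) simp
  then show "(A * B) $$ (i, j) \<in> K"
    using A B ij by (simp add: scalar_prod_def atLeast0LessThan)
qed

lemma det_in_subfield:
  assumes K: "is_subfield K" and "A \<in> mats_over K n"
  shows "det A \<in> K"
proof -
  have sign: "signof p \<in> K" for p :: "nat \<Rightarrow> nat"
    using K by (cases p rule: sign_cases) (simp_all add: is_subfield_def)
  have A: "A \<in> carrier_mat n n" "\<And>i j. i < n \<Longrightarrow> j < n \<Longrightarrow> A $$ (i, j) \<in> K"
    using assms(2) by (auto simp: mats_over_iff)
  have "signof p * (\<Prod>i = 0..<n. A $$ (i, p i)) \<in> K" if "p permutes {0..<n}" for p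
  proof -
    have "(\<Prod>i = 0..<n. A $$ (i, p i)) \<in> K"
      using A(2) permutes_in_image[OF that] by (intro subfield_prod[OF K]) auto
    then show ?thesis
      using sign K by (simp add: is_subfield_def)
  qed
  then show ?thesis
    unfolding det_def'[OF A(1)] by (intro subfield_sum[OF K]) auto
qed

lemma similar_overI:
  assumes K: "is_subfield K" and A: "A \<in> carrier_mat n n" and J: "J \<in> carrier_mat n n"
    and P: "P \<in> mats_over K n" and AP: "A * P = P * J"
    and inj: "\<And>v. v \<in> carrier_vec n \<Longrightarrow> P *\<^sub>v v = 0\<^sub>v n \<Longrightarrow> v = 0\<^sub>v n"
  shows "similar_over K n A J"
proof -
  have Pc: "P \<in> carrier_mat n n"
    using P by (simp add: mats_over_iff)
  have det0: "det P \<noteq> 0"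
    using inj unfolding det_0_iff_vec_prod_zero[OF Pc] by blast
  define Q where "Q = inverse (det P) \<cdot>\<^sub>m adj_mat P"
  have Qc: "Q \<in> carrier_mat n n"
    using adj_mat(1)[OF Pc] by (simp add: Q_def)
  have PQ: "P * Q = 1\<^sub>m n"
    using adj_mat[OF Pc] Pc det0 by (simp add: Q_def mult_smult_distrib[OF Pc adj_mat(1)[OF Pc]])
      (intro eq_matI; simp)
  have QP: "Q * P = 1\<^sub>m n"
    using adj_mat[OF Pc] Pc det0 by (simp add: Q_def mult_smult_assoc_mat[OF adj_mat(1)[OF Pc] Pc])
      (intro eq_matI; simp)
  have "Q \<in> mats_over K n"
  proof -
    have minor: "det (mat_delete P i j) \<in> K" if "i < n" "j < n" for i j
    proof (rule det_in_subfield[OF K])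
      show "mat_delete P i j \<in> mats_over K (n - 1)"
        using P that unfolding mats_over_iff by (auto simp: mat_delete_def)
    qed
    have "(- 1) ^ m \<in> K" for m
      using K by (intro subfield_power) (simp_all add: is_subfield_def)
    then have "inverse (det P) * cofactor P j i \<in> K" if "i < n" "j < n" for i j
      using K minor[OF that(2,1)] det_in_subfield[OF K P] by (simp add: cofactor_def is_subfield_def)
    then show ?thesis
      using Qc Pc unfolding mats_over_iff by (auto simp: Q_def adj_mat_def)
  qed
  moreover have "A = P * J * Q"
    using A Pc Qc PQ by (simp flip: AP add: assoc_mult_mat[OF A Pc Qc])
  then have "similar_mat_wit A J P Q"
    using A J Pc Qc PQ QP by (intro similar_mat_witI[where n = n]) auto
  ultimately show ?thesis
    using P unfolding similar_over_def by blast
qed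

subsection \<open>Pairs of truncated polynomials\<close>

no_notation fps_nth (infixl \<open>$\<close> 75)
no_notation fls_nth (infixl \<open>$$\<close> 75)

text \<open>The coordinates of \<open>(f, g)\<close> in \<open>K[x] / x ^ a \<times> K[x] / x ^ b\<close>, with the highest power first,
  so that multiplication by \<open>x\<close> is given by the Jordan matrix with blocks of sizes \<open>a\<close> and \<open>b\<close>.\<close>

definition pair_vec :: "nat \<Rightarrow> nat \<Rightarrow> 'a::comm_ring_1 poly \<Rightarrow> 'a poly \<Rightarrow> 'a vec" where
  "pair_vec a b f g =
    vec (a + b) (\<lambda>i. if i < a then coeff f (a - 1 - i) else coeff g (a + b - 1 - i))"

lemma pair_vec_carrier [simp]: "pair_vec a b f g \<in> carrier_vec (a + b)"
  by (simp add: pair_vec_def)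

lemma dim_pair_vec [simp]: "dim_vec (pair_vec a b f g) = a + b"
  by (simp add: pair_vec_def)

lemma pair_vec_eq_iff:
  "pair_vec a b f g = pair_vec a b f' g' \<longleftrightarrow>
    (\<forall>i<a. coeff f i = coeff f' i) \<and> (\<forall>i<b. coeff g i = coeff g' i)"
proof
  assume eq: "pair_vec a b f g = pair_vec a b f' g'"
  have "coeff f i = coeff f' i" if "i < a" for i
    using arg_cong[OF eq, of "\<lambda>v. v $ (a - 1 - i)"] that by (simp add: pair_vec_def)
  moreover have "coeff g i = coeff g' i" if "i < b" for i
    using arg_cong[OF eq, of "\<lambda>v. v $ (a + b - 1 - i)"] that
    by (simp add: pair_vec_def split: if_splits)
  ultimately show "(\<forall>i<a. coeff f i = coeff f' i) \<and> (\<forall>i<b. coeff g i = coeff g' i)"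
    by blast
qed (auto simp: pair_vec_def intro!: eq_vecI)

lemma pair_vec_0 [simp]: "pair_vec a b 0 0 = 0\<^sub>v (a + b)"
  by (auto simp: pair_vec_def)

lemma pair_vec_eq_0_iff:
  "pair_vec a b f g = 0\<^sub>v (a + b) \<longleftrightarrow> (\<forall>i<a. coeff f i = 0) \<and> (\<forall>i<b. coeff g i = 0)"
  using pair_vec_eq_iff[of a b f g 0 0] by simp

lemma pair_vec_add: "pair_vec a b f g + pair_vec a b f' g' = pair_vec a b (f + f') (g + g')"
  by (auto simp: pair_vec_def)

lemma pair_vec_smult:
  "c \<cdot>\<^sub>v pair_vec a b f g = pair_vec a b (Polynomial.smult c f) (Polynomial.smult c g)"
  by (auto simp: pair_vec_def)

lemma pair_vec_surj:
  assumes "v \<in> carrier_vec (a + b)"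
  obtains f g where "v = pair_vec a b f g" "\<And>i. coeff f i \<in> insert 0 (vec_index v ` {..<a + b})"
    "\<And>i. coeff g i \<in> insert 0 (vec_index v ` {..<a + b})"
proof
  define f where "f = (\<Sum>i<a. monom (v $ (a - 1 - i)) i)"
  define g where "g = (\<Sum>i<b. monom (v $ (a + b - 1 - i)) i)"
  have f: "coeff f i = (if i < a then v $ (a - 1 - i) else 0)" for i
    by (simp add: coeff_sum f_def)
  have g: "coeff g i = (if i < b then v $ (a + b - 1 - i) else 0)" for i
    by (simp add: coeff_sum g_def)
  show "v = pair_vec a b f g"
    using assms by (auto simp: pair_vec_def f g intro!: eq_vecI)
  show "coeff f i \<in> insert 0 (vec_index v ` {..<a + b})" for i
    by (auto simp: f)
  show "coeff g i \<in> insert 0 (vec_index v ` {..<a + b})" for i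
    by (auto simp: g)
qed

abbreviation jordan2 :: "nat \<Rightarrow> nat \<Rightarrow> 'a::comm_ring_1 mat" where
  "jordan2 a b \<equiv> jordan_matrix [(a, 0), (b, 0)]"

lemma jordan2_carrier [simp]: "jordan2 a b \<in> carrier_mat (a + b) (a + b)"
  using jordan_matrix_carrier[of "[(a, 0), (b, 0)]"] by simp

lemma jordan2_index:
  assumes "i < a + b" "j < a + b"
  shows "jordan2 a b $$ (i, j) = (if Suc i = j \<and> j \<noteq> a then 1 else 0)"
  using assms by (auto simp: jordan_matrix_def Let_def)

lemma jordan2_mult_vec:
  assumes "v \<in> carrier_vec (a + b)"
  shows "jordan2 a b *\<^sub>v v = vec (a + b) (\<lambda>i. if Suc i < a + b \<and> Suc i \<noteq> a then v $ Suc i else 0)"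
proof (rule eq_vecI)
  fix i assume "i < dim_vec (vec (a + b) (\<lambda>i. if Suc i < a + b \<and> Suc i \<noteq> a then v $ Suc i else 0))"
  then have i: "i < a + b"
    by simp
  have "(jordan2 a b *\<^sub>v v) $ i = (\<Sum>j<a + b. jordan2 a b $$ (i, j) * v $ j)"
    using i assms by (simp add: scalar_prod_def atLeast0LessThan)
  also have "\<dots> = (\<Sum>j<a + b. if Suc i = j then if j \<noteq> a then v $ j else 0 else 0)"
    using i by (intro sum.cong) (simp_all add: jordan2_index)
  also have "\<dots> = (if Suc i < a + b \<and> Suc i \<noteq> a then v $ Suc i else 0)"
    by (simp add: sum.delta')
  finally show "(jordan2 a b *\<^sub>v v) $ i
      = vec (a + b) (\<lambda>i. if Suc i < a + b \<and> Suc i \<noteq> a then v $ Suc i else 0) $ i"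
    using i by simp
qed simp

lemma jordan2_mult_pair_vec:
  fixes f g :: "'a::comm_ring_1 poly"
  shows "jordan2 a b *\<^sub>v pair_vec a b f g = pair_vec a b (monom 1 1 * f) (monom 1 1 * g)"
  unfolding jordan2_mult_vec[OF pair_vec_carrier]
proof (rule eq_vecI)
  fix i assume "i < dim_vec (pair_vec a b (monom 1 1 * f) (monom 1 1 * g))"
  then show "vec (a + b) (\<lambda>i. if Suc i < a + b \<and> Suc i \<noteq> a
      then pair_vec a b f g $ Suc i else 0) $ i
      = pair_vec a b (monom 1 1 * f) (monom 1 1 * g) $ i"
    by (cases "Suc i < a"; cases "Suc i = a"; cases "Suc i = a + b")
      (simp_all add: pair_vec_def coeff_monom_mult)
qed simp

lemma jordan2_funpow_pair_vec:
  fixes f g :: "'a::comm_ring_1 poly"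
  shows "((*\<^sub>v) (jordan2 a b) ^^ n) (pair_vec a b f g) = pair_vec a b (monom 1 n * f) (monom 1 n * g)"
proof (induction n)
  case (Suc n)
  have "monom 1 1 * (monom 1 n * p) = monom 1 (Suc n) * p" for p :: "'a poly"
    by (simp only: mult.assoc[symmetric] mult_monom) simp
  then show ?case
    by (simp only: funpow.simps comp_apply Suc jordan2_mult_pair_vec)
qed (simp add: monom_0 one_pCons[symmetric])

lemma funpow_mult_mat_vec_carrier:
  assumes "A \<in> carrier_mat n n" "v \<in> carrier_vec n"
  shows "((*\<^sub>v) A ^^ m) v \<in> carrier_vec n"
  using assms by (induction m) auto

lemma funpow_intertwine:
  assumes "A \<in> carrier_mat n n" "B \<in> carrier_mat n n" "P \<in> carrier_mat n n" "A * P = P * B"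
    and "v \<in> carrier_vec n"
  shows "((*\<^sub>v) A ^^ m) (P *\<^sub>v v) = P *\<^sub>v (((*\<^sub>v) B ^^ m) v)"
proof (induction m)
  case (Suc m)
  let ?w = "((*\<^sub>v) B ^^ m) v"
  have w: "?w \<in> carrier_vec n"
    using assms by (intro funpow_mult_mat_vec_carrier)
  have "A *\<^sub>v (P *\<^sub>v ?w) = P *\<^sub>v (B *\<^sub>v ?w)"
    using assms w by (simp flip: assoc_mult_mat_vec)
  then show ?case
    using Suc by simp
qed simp

text \<open>Apply the hypothesis to the last nonzero vector among \<open>v, J v, J\<^sup>2 v, \<dots>\<close> for a nilpotent
  Jordan matrix \<open>J\<close>.\<close>

lemma intertwining_inj:
  fixes A :: "'a::comm_ring_1 mat"
  assumes A: "A \<in> carrier_mat (a + b) (a + b)" and P: "P \<in> carrier_mat (a + b) (a + b)"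
    and AP: "A * P = P * jordan2 a b"
    and ker: "\<And>w. w \<in> carrier_vec (a + b) \<Longrightarrow> jordan2 a b *\<^sub>v w = 0\<^sub>v (a + b) \<Longrightarrow>
      P *\<^sub>v w = 0\<^sub>v (a + b) \<Longrightarrow> w = 0\<^sub>v (a + b)"
    and v: "v \<in> carrier_vec (a + b)" "P *\<^sub>v v = 0\<^sub>v (a + b)"
  shows "v = 0\<^sub>v (a + b)"
proof -
  let ?J = "jordan2 a b :: 'a mat"
  let ?z = "0\<^sub>v (a + b) :: 'a vec"
  obtain f g where "v = pair_vec a b f g"
    using pair_vec_surj[OF v(1)] by metis
  then have "((*\<^sub>v) ?J ^^ (a + b)) v = ?z"
    by (simp add: jordan2_funpow_pair_vec pair_vec_eq_0_iff coeff_monom_mult)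
  moreover have "((*\<^sub>v) ?J ^^ m) v = ?z \<Longrightarrow> v = ?z" for m
  proof (induction m)
    case (Suc m)
    let ?w = "((*\<^sub>v) ?J ^^ m) v"
    have "P *\<^sub>v ?w = ((*\<^sub>v) A ^^ m) (P *\<^sub>v v)"
      using funpow_intertwine[OF A _ P AP v(1)] by simp
    also have "\<dots> = ?z"
      using A v(2) by (induction m) auto
    finally have "P *\<^sub>v ?w = ?z" .
    moreover have "?w \<in> carrier_vec (a + b)"
      by (rule funpow_mult_mat_vec_carrier[OF jordan2_carrier v(1)])
    moreover have "?J *\<^sub>v ?w = ?z"
      using Suc.prems by (simp only: funpow.simps comp_apply)
    ultimately have "?w = ?z"
      by (rule ker[rotated 2])
    then show ?case
      by (rule Suc.IH)
  qed simp
  ultimately show ?thesis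
    by blast
qed

definition pair_mat :: "nat \<Rightarrow> 'a::comm_ring_1 poly \<Rightarrow> 'a poly \<Rightarrow> 'a poly \<Rightarrow> 'a poly \<Rightarrow> 'a mat" where
  "pair_mat k A B C D = mat (k + k) (k + k) (\<lambda>(i, j).
    if j < k then pair_vec k k (monom 1 (k - 1 - j) * A) (monom 1 (k - 1 - j) * C) $ i
    else pair_vec k k (monom 1 (k + k - 1 - j) * B) (monom 1 (k + k - 1 - j) * D) $ i)"

lemma pair_mat_carrier [simp]: "pair_mat k A B C D \<in> carrier_mat (k + k) (k + k)"
  by (simp add: pair_mat_def)

lemma coeff_mult_eq_sum_shifts:
  fixes A f :: "'a::comm_ring_1 poly"
  assumes "n < k"
  shows "(\<Sum>j<k. coeff (monom 1 (k - 1 - j) * A) n * coeff f (k - 1 - j)) = coeff (A * f) n"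
proof -
  have "(\<Sum>j<k. coeff (monom 1 (k - 1 - j) * A) n * coeff f (k - 1 - j))
      = (\<Sum>j<k. coeff (monom 1 j * A) n * coeff f j)"
    using sum.nat_diff_reindex[of "\<lambda>j. coeff (monom 1 j * A) n * coeff f j" k] by simp
  also have "\<dots> = (\<Sum>j\<le>n. coeff f j * coeff A (n - j))"
    using assms by (intro sum.mono_neutral_cong_right) (auto simp: coeff_monom_mult)
  also have "\<dots> = coeff (A * f) n"
    by (simp add: coeff_mult mult.commute[of A])
  finally show ?thesis .
qed

lemma pair_mat_mult_pair_vec:
  "pair_mat k A B C D *\<^sub>v pair_vec k k f g = pair_vec k k (A * f + B * g) (C * f + D * g)"
proof (rule eq_vecI)
  fix i assume "i < dim_vec (pair_vec k k (A * f + B * g) (C * f + D * g))"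
  then have i: "i < k + k"
    by simp
  let ?M = "pair_mat k A B C D"
  let ?v = "pair_vec k k f g"
  let ?S = "\<lambda>X Y h. \<Sum>j<k.
      pair_vec k k (monom 1 (k - 1 - j) * X) (monom 1 (k - 1 - j) * Y) $ i * coeff h (k - 1 - j)"
  have "(?M *\<^sub>v ?v) $ i = (\<Sum>j\<in>{0..<k + k}. ?M $$ (i, j) * ?v $ j)"
    using i by (simp add: scalar_prod_def pair_mat_def)
  also have "\<dots> = (\<Sum>j<k. ?M $$ (i, j) * ?v $ j) + (\<Sum>j<k. ?M $$ (i, j + k) * ?v $ (j + k))"
    using sum.atLeastLessThan_concat[of 0 k "k + k" "\<lambda>j. ?M $$ (i, j) * ?v $ j"]
      sum.shift_bounds_nat_ivl[of "\<lambda>j. ?M $$ (i, j) * ?v $ j" 0 k k]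
    by (simp add: atLeast0LessThan)
  also have "(\<Sum>j<k. ?M $$ (i, j) * ?v $ j) = ?S A C f"
    using i by (intro sum.cong) (auto simp: pair_mat_def pair_vec_def)
  also have "(\<Sum>j<k. ?M $$ (i, j + k) * ?v $ (j + k)) = ?S B D g"
    using i by (intro sum.cong) (auto simp: pair_mat_def pair_vec_def)
  finally have eq: "(?M *\<^sub>v ?v) $ i = ?S A C f + ?S B D g" .
  show "(?M *\<^sub>v ?v) $ i = pair_vec k k (A * f + B * g) (C * f + D * g) $ i"
  proof (cases "i < k")
    case True
    then show ?thesis
      unfolding eq using coeff_mult_eq_sum_shifts[of "k - 1 - i" k A f]
        coeff_mult_eq_sum_shifts[of "k - 1 - i" k B g]
      by (simp add: pair_vec_def)
  next
    case False
    then show ?thesis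
      unfolding eq using i coeff_mult_eq_sum_shifts[of "k + k - 1 - i" k C f]
        coeff_mult_eq_sum_shifts[of "k + k - 1 - i" k D g]
      by (simp add: pair_vec_def)
  qed
qed (simp add: pair_mat_def)

lemma pair_vec_index_in:
  assumes "0 \<in> K" "\<And>i. coeff f i \<in> K" "\<And>i. coeff g i \<in> K" "i < a + b"
  shows "pair_vec a b f g $ i \<in> K"
  using assms by (simp add: pair_vec_def)

lemma pair_mat_in_mats_over:
  fixes A B C D :: "'a::comm_ring_1 poly"
  assumes "0 \<in> K" "\<And>i. coeff A i \<in> K" "\<And>i. coeff B i \<in> K" "\<And>i. coeff C i \<in> K" "\<And>i. coeff D i \<in> K"
  shows "pair_mat k A B C D \<in> mats_over K (k + k)"
proof -
  have shift: "coeff (monom 1 n * f) i \<in> K" if "\<And>i. coeff f i \<in> K" for n i and f :: "'a poly"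
    using that assms(1) by (simp add: coeff_monom_mult)
  show ?thesis
    unfolding mats_over_iff
  proof (intro conjI allI impI)
    fix i j assume ij: "i < k + k" "j < k + k"
    have "pair_vec k k (monom 1 n * A) (monom 1 n * C) $ i \<in> K"
      "pair_vec k k (monom 1 n * B) (monom 1 n * D) $ i \<in> K" for n
      using assms shift ij by (intro pair_vec_index_in; blast)+
    then show "pair_mat k A B C D $$ (i, j) \<in> K"
      using ij by (simp add: pair_mat_def)
  qed simp
qed

subsection \<open>Construction of commuting matrices\<close>

lemma mat_eqI_mult_pair_vec:
  fixes A B :: "'a::comm_ring_1 mat"
  assumes A: "A \<in> carrier_mat (a + b) (a + b)" and B: "B \<in> carrier_mat (a + b) (a + b)"
    and eq: "\<And>f g. A *\<^sub>v pair_vec a b f g = B *\<^sub>v pair_vec a b f g"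
  shows "A = B"
proof (rule mat_col_eqI)
  fix j assume "j < dim_col B"
  then have j: "j < a + b"
    using B by simp
  let ?u = "col (1\<^sub>m (a + b)) j :: 'a vec"
  have "?u \<in> carrier_vec (a + b)"
    using j by simp
  then obtain f g where "?u = pair_vec a b f g"
    using pair_vec_surj by metis
  then have "A *\<^sub>v ?u = B *\<^sub>v ?u"
    using eq by simp
  then have "col (A * 1\<^sub>m (a + b)) j = col (B * 1\<^sub>m (a + b)) j"
    using col_mult2[OF A one_carrier_mat j] col_mult2[OF B one_carrier_mat j] by simp
  then show "col A j = col B j"
    using A B by simp
qed (use A B in auto)

lemma jordan2_kernel_index:
  assumes "v \<in> carrier_vec (a + b)" "jordan2 a b *\<^sub>v v = 0\<^sub>v (a + b)"
    and "j < a + b" "j \<noteq> 0" "j \<noteq> a"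
  shows "v $ j = 0"
proof -
  have "vec (a + b) (\<lambda>i. if Suc i < a + b \<and> Suc i \<noteq> a then v $ Suc i else 0) $ (j - 1) = 0"
    using assms(2,3) unfolding jordan2_mult_vec[OF assms(1)] by simp
  then show ?thesis
    using assms(3-5) by simp
qed

lemma pair_mat_commute: "jordan2 k k * pair_mat k A B C D = pair_mat k A B C D * jordan2 k k"
proof (rule mat_eqI_mult_pair_vec)
  show "jordan2 k k * pair_mat k A B C D *\<^sub>v pair_vec k k f g
      = pair_mat k A B C D * jordan2 k k *\<^sub>v pair_vec k k f g" for f g
    by (simp add: assoc_mult_mat_vec[of _ "k + k" "k + k" _ "k + k"] pair_mat_mult_pair_vec
        jordan2_mult_pair_vec algebra_simps)
qed (rule mult_carrier_mat[OF jordan2_carrier pair_mat_carrier] mult_carrier_mat[OF pair_mat_carrier jordan2_carrier])+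

text \<open>The matrix \<open>Y\<close> below is the conjugate by \<open>diag (x, 1)\<close> of \<open>x M\<close>, for the companion matrix \<open>M\<close>
  of \<open>z\<^sup>2 - t z + d\<close>. The vectors \<open>c i\<close> and \<open>e i\<close> form its two Jordan chains: the first one starts at
  \<open>(1, 0)\<close>, the second one at a multiple of \<open>M ^ (1 - k) (1, 0)\<close>, up to the conjugation.\<close>

lemma nilp_classes_commute_of_lucas:
  fixes t d :: "'a::field"
  assumes K: "is_subfield K" and td: "t \<in> K" "d \<in> K" "d \<noteq> 0"
    and u: "lucas t d k \<noteq> 0" and k: "k \<ge> 2"
  shows "nilp_classes_commute K [k, k] [k + 1, k - 1]"
proof -
  define U where "U = lucas t d"
  have U_rec: "U (Suc (Suc n)) = t * U (Suc n) - d * U n" for n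
    by (simp add: U_def)
  have U_01: "U 0 = 0" "U (Suc 0) = 1"
    by (simp_all add: U_def)
  have UK: "U n \<in> K" for n
    unfolding U_def using K td by (intro subfield_lucas) auto
  have K0: "0 \<in> K" "1 \<in> K" "\<And>x y. x \<in> K \<Longrightarrow> y \<in> K \<Longrightarrow> x * y \<in> K" "\<And>x. x \<in> K \<Longrightarrow> - x \<in> K"
    using K by (auto simp: is_subfield_def)
  let ?n = "k + k"
  have n: "(k + 1) + (k - 1) = ?n"
    using k by simp
  define Y where "Y = pair_mat k 0 (monom (- d) 2) 1 (monom t 1)"
  have Yc: "Y \<in> carrier_mat ?n ?n"
    by (simp add: Y_def)
  have coeffK: "coeff (monom c m) i \<in> K" if "c \<in> K" for c m i
    using that K0 by simp
  have YK: "Y \<in> mats_over K ?n"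
    unfolding Y_def using K0 td by (intro pair_mat_in_mats_over coeffK) (auto simp: coeff_1)
  have Y_mult: "Y *\<^sub>v pair_vec k k f g = pair_vec k k (monom (- d) 2 * g) (f + monom t 1 * g)" for f g
    by (simp add: Y_def pair_mat_mult_pair_vec)

  define c where "c i = (if i = 0 then pair_vec k k 1 0
    else pair_vec k k (monom (- d * U (i - 1)) i) (monom (U i) (i - 1)))" for i
  define e where "e i = pair_vec k k (monom (d ^ i * U (k - i)) (i + 1))
    (monom (- (d ^ i * U (k - 1 - i))) i)" for i
  have cc: "c i \<in> carrier_vec ?n" and ec: "e i \<in> carrier_vec ?n" for i
    by (simp_all add: c_def e_def)
  have Yc_step: "Y *\<^sub>v c i = c (Suc i)" for i
  proof (cases i)
    case (Suc m)
    then show ?thesis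
      by (simp add: c_def Y_mult mult_monom add_monom U_rec algebra_simps)
  qed (simp add: c_def Y_mult U_01 monom_0 one_pCons)
  have Ye_step: "Y *\<^sub>v e i = e (Suc i)" if "i \<le> k - 2" for i
  proof -
    define m where "m = k - 2 - i"
    have m: "k - i = Suc (Suc m)" "k - 1 - i = Suc m" "k - Suc i = Suc m" "k - 1 - Suc i = m"
      using that k by (simp_all add: m_def)
    show ?thesis
      unfolding e_def m Y_mult by (simp add: mult_monom add_monom U_rec algebra_simps)
  qed
  have c_top: "c (Suc k) = 0\<^sub>v ?n" and e_top: "e (k - 1) = 0\<^sub>v ?n"
    using k by (auto simp: c_def e_def pair_vec_eq_0_iff U_01)

  define h where "h j = (if j \<le> k then c (k - j) else e (?n - 1 - j))" for j
  define P where "P = mat ?n ?n (\<lambda>(i, j). h j $ i)"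
  have Pc: "P \<in> carrier_mat ?n ?n"
    by (simp add: P_def)
  have hc: "h j \<in> carrier_vec ?n" for j
    by (simp add: h_def cc ec)
  have colP: "col P j = h j" if "j < ?n" for j
    using that hc[of j] by (auto simp: P_def)
  have hK: "h j $ i \<in> K" if "i < ?n" for i j
    unfolding h_def c_def e_def using that K0 UK td subfield_power[OF K]
    by (auto intro!: pair_vec_index_in coeffK simp: coeff_1)
  have PK: "P \<in> mats_over K ?n"
    using hK by (simp add: mats_over_iff P_def)
  let ?J = "jordan2 (k + 1) (k - 1) :: 'a mat"
  have Jc: "?J \<in> carrier_mat ?n ?n"
    using jordan2_carrier[of "k + 1" "k - 1"] unfolding n .
  have YP: "Y * P = P * ?J"
  proof (rule mat_col_eqI)
    fix j assume "j < dim_col (P * ?J)"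
    then have j: "j < ?n"
      using k by simp
    have "col (Y * P) j = Y *\<^sub>v h j"
      using j by (simp add: col_mult2[OF Yc Pc] colP)
    also have "\<dots> = (if j = 0 \<or> j = k + 1 then 0\<^sub>v ?n else h (j - 1))"
    proof -
      consider "j = 0" | "0 < j" "j \<le> k" | "j = k + 1" | "j > k + 1"
        by linarith
      then show ?thesis
      proof cases
        case 1
        then show ?thesis
          by (simp add: h_def Yc_step c_top)
      next
        case 2
        then show ?thesis
          by (auto simp: h_def Yc_step Suc_diff_le)
      next
        case 3
        have "Suc (k - 2) = k - 1" "?n - 1 - (k + 1) = k - 2"
          using k by auto
        then show ?thesis
          using 3 Ye_step[of "k - 2"] e_top by (simp add: h_def)
      next
        case 4
        then have "Suc (?n - 1 - j) = ?n - 1 - (j - 1)" "?n - 1 - j \<le> k - 2" "\<not> j - 1 \<le> k"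
          using j by auto
        then show ?thesis
          using 4 Ye_step[of "?n - 1 - j"] by (simp add: h_def)
      qed
    qed
    also have "\<dots> = P *\<^sub>v col ?J j"
    proof -
      have "col ?J j = (if j = 0 \<or> j = k + 1 then 0\<^sub>v ?n else unit_vec ?n (j - 1))"
        using j Jc n by (intro eq_vecI) (auto simp: jordan2_index unit_vec_def)
      moreover have "P *\<^sub>v 0\<^sub>v ?n = 0\<^sub>v ?n"
        using Pc by auto
      moreover have "P *\<^sub>v unit_vec ?n i = h i" if "i < ?n" for i
        using that colP col_mult2[OF Pc one_carrier_mat that] Pc by simp
      ultimately show ?thesis
        using j by simp
    qed
    also have "\<dots> = col (P * ?J) j"
      by (rule col_mult2[OF Pc Jc j, symmetric])
    finally show "col (Y * P) j = col (P * ?J) j" .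
  qed (use Yc Pc k in auto)
  have inj: "v = 0\<^sub>v ?n" if "v \<in> carrier_vec ?n" "P *\<^sub>v v = 0\<^sub>v ?n" for v
  proof (rule intertwining_inj[of Y "k + 1" "k - 1" P, unfolded n])
    fix w :: "'a vec"
    assume w: "w \<in> carrier_vec ?n" "?J *\<^sub>v w = 0\<^sub>v ?n" "P *\<^sub>v w = 0\<^sub>v ?n"
    have w0: "w $ j = 0" if "j < ?n" "j \<noteq> 0" "j \<noteq> k + 1" for j
      using jordan2_kernel_index[of w "k + 1" "k - 1" j, unfolded n] w(1,2) that by blast
    have row: "h 0 $ i * w $ 0 + h (k + 1) $ i * w $ (k + 1) = 0" if i: "i < ?n" for i
    proof -
      have "(P *\<^sub>v w) $ i = (\<Sum>j<?n. h j $ i * w $ j)"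
        using i w(1) by (simp add: scalar_prod_def P_def atLeast0LessThan)
      also have "\<dots> = (\<Sum>j\<in>{0, k + 1}. h j $ i * w $ j)"
        using k w0 by (intro sum.mono_neutral_right) auto
      finally show ?thesis
        using w(3) i by simp
    qed
    have h0: "h 0 = pair_vec k k (monom (- d * U (k - 1)) k) (monom (U k) (k - 1))"
      using k by (simp add: h_def c_def)
    have "?n - 1 - (k + 1) = k - 2" "k - (k - 2) = 2" "k - 1 - (k - 2) = Suc 0"
      using k by auto
    then have h1: "h (k + 1) = pair_vec k k (monom (d ^ (k - 2) * U 2) (k - 2 + 1))
        (monom (- (d ^ (k - 2))) (k - 2))"
      by (simp add: h_def e_def U_01)
    have ne: "k - Suc 0 \<noteq> k - 2"
      using k by simp
    have "w $ (k + 1) = 0"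
      using row[of "k + 1"] k td(3) ne unfolding h0 h1 by (simp add: pair_vec_def)
    moreover from this have "w $ 0 = 0"
      using row[of k] k u unfolding h0 by (simp add: pair_vec_def U_def)
    ultimately have "w $ j = 0" if "j < ?n" for j
      using w0[OF that] by (cases "j = 0"; cases "j = k + 1") simp_all
    then show "w = 0\<^sub>v ?n"
      using w(1) by (intro eq_vecI) auto
  qed (use that Yc Pc YP in auto)
  have "similar_over K ?n Y ?J"
    using K Yc Jc PK YP inj by (rule similar_overI)
  then have "Y \<in> nilp_class K [k + 1, k - 1]"
    using YK k by (simp add: nilp_class_def)
  moreover have "jordan2 k k \<in> nilp_class K [k, k]"
  proof -
    have "jordan2 k k \<in> mats_over K ?n"
      using K0 by (auto simp: mats_over_iff jordan2_index)
    moreover have "1\<^sub>m ?n \<in> mats_over K ?n"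
      using K0 by (simp add: mats_over_iff)
    moreover have "similar_mat_wit (jordan2 k k :: 'a mat) (jordan2 k k) (1\<^sub>m ?n) (1\<^sub>m ?n)"
      by (intro similar_mat_wit_refl) simp
    ultimately show ?thesis
      by (auto simp: nilp_class_def similar_over_def)
  qed
  ultimately show ?thesis
    unfolding nilp_classes_commute_def Y_def using pair_mat_commute by blast
qed

subsection \<open>Nilpotent operators on pairs of polynomials\<close>

lemma poly_lucas: "poly (lucas t d n) z = lucas (poly t z) (poly d z) n"
  by (induction n rule: induct_nat_012) simp_all

lemma lucas_scale: "lucas (x * t) (x ^ 2 * d) (Suc n) = x ^ n * lucas t d (Suc n)"
proof (induction n rule: induct_nat_012)
  case (ge2 n)
  have "lucas (x * t) (x ^ 2 * d) (Suc (Suc (Suc n)))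
      = x * t * lucas (x * t) (x ^ 2 * d) (Suc (Suc n)) - x ^ 2 * d * lucas (x * t) (x ^ 2 * d) (Suc n)"
    by simp
  also have "\<dots> = x ^ Suc (Suc n) * lucas t d (Suc (Suc (Suc n)))"
    unfolding ge2 by (simp add: algebra_simps power2_eq_square)
  finally show ?case .
qed auto

lemma lucas_0_right: "lucas t 0 (Suc n) = t ^ n"
  by (induction n rule: induct_nat_012) simp_all

lemma monom_dvd_mult_cancel:
  fixes f g :: "'a::field poly"
  assumes "poly f 0 \<noteq> 0" "monom 1 j dvd f * g"
  shows "monom 1 j dvd g"
proof (cases "g = 0")
  case False
  moreover have "f \<noteq> 0"
    using assms(1) by auto
  moreover have "order 0 f = 0"
    using assms(1) by (rule order_0I)
  ultimately show ?thesis
    using assms(2) by (simp add: monom_1_dvd_iff order_mult)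
qed simp

lemma monom_1_dvd_iff_root: "monom 1 (Suc 0) dvd f \<longleftrightarrow> poly f 0 = (0::'a::comm_ring_1)"
  by (simp add: monom_1_dvd_iff' poly_0_coeff_0)

lemma monom_Suc_dvd_mult_monom:
  fixes f :: "'a::idom poly"
  shows "monom 1 (i + j) dvd monom 1 i * f \<longleftrightarrow> monom 1 j dvd f"
proof -
  have "monom 1 (i + j) = monom 1 i * monom (1::'a) j"
    by (simp add: mult_monom)
  then show ?thesis
    by (simp add: monom_eq_0_iff)
qed

definition pair_op :: "'a::comm_ring_1 poly \<Rightarrow> 'a poly \<Rightarrow> 'a poly \<Rightarrow> 'a poly \<Rightarrow>
    'a poly \<times> 'a poly \<Rightarrow> 'a poly \<times> 'a poly" where
  "pair_op A B C D p = (A * fst p + B * snd p, C * fst p + D * snd p)"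

definition pair_dvd :: "'a::comm_ring_1 poly \<Rightarrow> 'a poly \<times> 'a poly \<Rightarrow> bool" where
  "pair_dvd q p \<longleftrightarrow> q dvd fst p \<and> q dvd snd p"

context
  fixes A B C D :: "'a::field poly"
begin

private abbreviation (input) "N \<equiv> pair_op A B C D"
private abbreviation (input) "tr \<equiv> A + D"
private abbreviation (input) "dt \<equiv> A * D - B * C"

lemma pair_op_pair_op:
  "fst (N (N p)) = tr * fst (N p) - dt * fst p"
  "snd (N (N p)) = tr * snd (N p) - dt * snd p"
  by (simp_all add: pair_op_def algebra_simps)

lemma pair_op_funpow:
  "fst ((N ^^ Suc m) p) = lucas tr dt (Suc m) * fst (N p) - dt * lucas tr dt m * fst p \<and>
   snd ((N ^^ Suc m) p) = lucas tr dt (Suc m) * snd (N p) - dt * lucas tr dt m * snd p"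
proof (induction m arbitrary: p)
  case (Suc m)
  have "(N ^^ Suc (Suc m)) p = (N ^^ Suc m) (N p)"
    by (simp only: funpow_Suc_right comp_apply)
  then show ?case
    using Suc[of "N p"] by (simp only: pair_op_pair_op lucas.simps(3)) (simp add: algebra_simps)
qed simp

lemma pair_dvd_pair_op: "pair_dvd q p \<Longrightarrow> pair_dvd q (N p)"
  by (simp add: pair_dvd_def pair_op_def)

lemma pair_dvd_funpow: "pair_dvd q p \<Longrightarrow> pair_dvd q ((N ^^ m) p)"
  by (induction m) (simp_all add: pair_dvd_pair_op)

text \<open>Multiply by the adjugate matrix.\<close>

lemma pair_dvd_det:
  assumes "pair_dvd q (N p)"
  shows "q dvd dt * fst p" "q dvd dt * snd p"
proof -
  have "dt * fst p = D * fst (N p) - B * snd (N p)" "dt * snd p = A * snd (N p) - C * fst (N p)"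
    by (simp_all add: pair_op_def algebra_simps)
  moreover have "q dvd fst (N p)" "q dvd snd (N p)"
    using assms by (simp_all add: pair_dvd_def)
  ultimately show "q dvd dt * fst p" "q dvd dt * snd p"
    by simp_all
qed

context
  fixes k :: nat
  assumes k: "k \<ge> 3" and nilp: "\<And>p. pair_dvd (monom 1 k) ((N ^^ Suc k) p)"
begin

lemma det_root: "poly dt 0 = 0"
proof (rule ccontr)
  assume dt0: "poly dt 0 \<noteq> 0"
  have "pair_dvd (monom 1 k) ((N ^^ m) p) \<Longrightarrow> pair_dvd (monom 1 k) p" for m p
  proof (induction m)
    case (Suc m)
    then have "pair_dvd (monom 1 k) (N ((N ^^ m) p))"
      by simp
    then have "pair_dvd (monom 1 k) ((N ^^ m) p)"
      using pair_dvd_det monom_dvd_mult_cancel[OF dt0] unfolding pair_dvd_def by blast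
    then show ?case
      by (rule Suc.IH)
  qed simp
  from this[OF nilp[of "(1, 0)"]] have "coeff (1 :: 'a poly) 0 = 0"
    using k unfolding pair_dvd_def monom_1_dvd_iff' fst_conv by (auto dest: spec[of _ 0])
  then show False
    by simp
qed

lemma trace_root: "poly tr 0 = 0"
proof (rule ccontr)
  assume tr0: "poly tr 0 \<noteq> 0"
  have "poly (fst (N p)) 0 = 0 \<and> poly (snd (N p)) 0 = 0" for p
  proof -
    have "poly f 0 = 0" if "monom 1 k dvd f" for f :: "'a poly"
      using that k by (simp add: monom_1_dvd_iff' poly_0_coeff_0)
    then have "poly (fst ((N ^^ Suc k) p)) 0 = 0" "poly (snd ((N ^^ Suc k) p)) 0 = 0"
      using nilp[of p] by (simp_all only: pair_dvd_def)
    then have "lucas (poly tr 0) 0 (Suc k) * poly (fst (N p)) 0 = 0"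
      "lucas (poly tr 0) 0 (Suc k) * poly (snd (N p)) 0 = 0"
      using det_root by (simp_all only: pair_op_funpow poly_diff poly_mult poly_lucas) simp_all
    then show ?thesis
      using tr0 by (simp only: lucas_0_right) simp
  qed
  from this[of "(1, 0)"] this[of "(0, 1)"] have "poly tr 0 = 0"
    by (simp add: pair_op_def)
  then show False
    using tr0 by contradiction
qed

text \<open>If \<open>x\<^sup>2\<close> did not divide the determinant, then \<open>N\<^sup>2\<close> would be \<open>x\<close> times an
  invertible map, which contradicts \<open>N ^ (k + 1) = 0\<close> as \<open>2 k - 2 \<ge> k + 1\<close>.\<close>

lemma square_dvd_det: "monom 1 2 dvd dt"
proof -
  obtain t' where t': "tr = monom 1 (Suc 0) * t'"
    using trace_root unfolding monom_1_dvd_iff_root[symmetric] by blast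
  obtain d' where d': "dt = monom 1 (Suc 0) * d'"
    using det_root unfolding monom_1_dvd_iff_root[symmetric] by blast
  have "poly d' 0 = 0"
  proof (rule ccontr)
    assume d0: "poly d' 0 \<noteq> 0"
    have step: "pair_dvd (monom 1 j) p" if "pair_dvd (monom 1 (Suc j)) (N (N p))" for j p
    proof -
      have cancel: "monom 1 j dvd f" if "monom 1 j dvd d' * f" for f
        using monom_dvd_mult_cancel[OF d0 that] .
      have "monom 1 (1 + j) dvd monom 1 1 * (t' * fst (N p) - d' * fst p)"
        "monom 1 (1 + j) dvd monom 1 1 * (t' * snd (N p) - d' * snd p)"
        using that unfolding pair_dvd_def pair_op_pair_op t' d' by (simp_all add: algebra_simps)
      then have 1: "monom 1 j dvd t' * fst (N p) - d' * fst p"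
        "monom 1 j dvd t' * snd (N p) - d' * snd p"
        by (simp_all only: monom_Suc_dvd_mult_monom)
      have "monom 1 j dvd monom (1::'a) (Suc j)"
        by (simp add: monom_1_dvd_iff')
      then have 2: "monom 1 j dvd fst (N (N p))" "monom 1 j dvd snd (N (N p))"
        using that unfolding pair_dvd_def by (blast intro: dvd_trans)+
      let ?q = "(t' * fst (N p) - d' * fst p, t' * snd (N p) - d' * snd p)"
      have "pair_dvd (monom 1 j) (N ?q)"
        using 1 by (intro pair_dvd_pair_op) (simp add: pair_dvd_def)
      moreover have "fst (N ?q) = t' * fst (N (N p)) - d' * fst (N p)"
        "snd (N ?q) = t' * snd (N (N p)) - d' * snd (N p)"
        by (simp_all add: pair_op_def algebra_simps)
      ultimately have "monom 1 j dvd t' * fst (N (N p)) - d' * fst (N p)"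
        "monom 1 j dvd t' * snd (N (N p)) - d' * snd (N p)"
        by (simp_all only: pair_dvd_def)
      then have "monom 1 j dvd d' * fst (N p)" "monom 1 j dvd d' * snd (N p)"
        using 2 by (metis dvd_diff_right_iff dvd_mult)+
      then have "monom 1 j dvd fst (N p)" "monom 1 j dvd snd (N p)"
        using cancel by blast+
      then have "monom 1 j dvd d' * fst p" "monom 1 j dvd d' * snd p"
        using 1 by (metis dvd_diff_right_iff dvd_mult)+
      then show ?thesis
        unfolding pair_dvd_def using cancel by blast
    qed
    have steps: "pair_dvd (monom 1 (i + j)) ((N ^^ (2 * i)) p) \<Longrightarrow> pair_dvd (monom 1 j) p" for i j p
    proof (induction i)
      case (Suc i)
      have "(N ^^ (2 * Suc i)) p = N (N ((N ^^ (2 * i)) p))"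
        by simp
      then show ?case
        using Suc step by (simp only: add_Suc)
    qed simp
    have "(N ^^ (2 * (k - 1))) (1, 0) = (N ^^ (k - 3)) ((N ^^ Suc k) (1, 0))"
    proof -
      have "2 * (k - 1) = (k - 3) + Suc k"
        using k by simp
      then show ?thesis
        by (simp only: funpow_add comp_apply)
    qed
    then have "pair_dvd (monom 1 ((k - 1) + 1)) ((N ^^ (2 * (k - 1))) (1, 0))"
      using pair_dvd_funpow[OF nilp] k by simp
    then have "pair_dvd (monom 1 1 :: 'a poly) (1, 0)"
      by (rule steps)
    then show False
      unfolding pair_dvd_def One_nat_def monom_1_dvd_iff_root by simp
  qed
  then have "monom 1 (Suc 0) dvd d'"
    by (simp only: monom_1_dvd_iff_root)
  then obtain d'' where "d' = monom 1 (Suc 0) * d''" ..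
  then have "dt = monom 1 2 * d''"
    using d' by (simp add: mult_monom numeral_2_eq_2 flip: mult.assoc)
  then show ?thesis
    by simp
qed

lemma lucas_nonzero_of_funpow:
  assumes "\<not> pair_dvd (monom 1 k) ((N ^^ k) p)"
  shows "lucas (coeff tr 1) (coeff dt 2) k \<noteq> 0" and "\<not> pair_dvd (monom 1 1) (N p)"
proof -
  obtain t' where t': "tr = monom 1 1 * t'"
    using trace_root unfolding monom_1_dvd_iff_root[symmetric] by auto
  obtain d' where d': "dt = (monom 1 1) ^ 2 * d'"
    using square_dvd_det by (auto simp: monom_power)
  let ?u = "lucas t' d' k"
  have "k = Suc (Suc (k - 2))"
    using k by simp
  then obtain m where m: "k = Suc (Suc m)" ..
  have L: "lucas tr dt k = monom 1 (Suc m) * ?u" "dt * lucas tr dt (Suc m) = monom 1 k * (d' * lucas t' d' (Suc m))"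
    unfolding t' d' m lucas_scale by (simp_all add: monom_power mult_monom)
  have N: "fst ((N ^^ k) p) = monom 1 (Suc m) * (?u * fst (N p)) - monom 1 k * (d' * lucas t' d' (Suc m) * fst p)"
    "snd ((N ^^ k) p) = monom 1 (Suc m) * (?u * snd (N p)) - monom 1 k * (d' * lucas t' d' (Suc m) * snd p)"
    using pair_op_funpow[of "Suc m" p] unfolding m[symmetric] L by (simp_all only: mult.assoc)
  have "\<not> pair_dvd (monom 1 1) (?u * fst (N p), ?u * snd (N p))"
  proof
    assume "pair_dvd (monom 1 1) (?u * fst (N p), ?u * snd (N p))"
    then have "monom 1 (Suc m + 1) dvd monom 1 (Suc m) * (?u * fst (N p))"
      "monom 1 (Suc m + 1) dvd monom 1 (Suc m) * (?u * snd (N p))"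
      unfolding monom_Suc_dvd_mult_monom pair_dvd_def by simp_all
    then have "pair_dvd (monom 1 k) ((N ^^ k) p)"
      unfolding pair_dvd_def N by (simp add: m)
    then show False
      using assms by contradiction
  qed
  then have "poly ?u 0 \<noteq> 0" and *: "\<not> pair_dvd (monom 1 1) (N p)"
    by (auto simp: pair_dvd_def monom_1_dvd_iff_root)
  moreover have "coeff tr 1 = poly t' 0" "coeff dt 2 = poly d' 0"
    unfolding t' d' by (simp_all add: coeff_monom_mult monom_power poly_0_coeff_0)
  ultimately show "lucas (coeff tr 1) (coeff dt 2) k \<noteq> 0" "\<not> pair_dvd (monom 1 1) (N p)"
    by (simp_all add: poly_lucas)
qed

text \<open>With \<open>v = (tr - N) p\<close>, the vector \<open>x ^ (k - 3) v\<close> and its multiples by \<open>x\<close> and \<open>x\<^sup>2\<close>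
  would be three independent elements of the kernel.\<close>

lemma det_coeff_nonzero:
  assumes p: "\<not> pair_dvd (monom 1 1) (N p)"
    and ker: "\<And>z0 z1 z2. pair_dvd (monom 1 k) (N z0) \<Longrightarrow> pair_dvd (monom 1 k) (N z1) \<Longrightarrow>
      pair_dvd (monom 1 k) (N z2) \<Longrightarrow> \<exists>c0 c1 c2. (c0 \<noteq> 0 \<or> c1 \<noteq> 0 \<or> c2 \<noteq> 0) \<and>
        pair_dvd (monom 1 k)
          (Polynomial.smult c0 (fst z0) + Polynomial.smult c1 (fst z1) + Polynomial.smult c2 (fst z2),
           Polynomial.smult c0 (snd z0) + Polynomial.smult c1 (snd z1) + Polynomial.smult c2 (snd z2))"
  shows "coeff dt 2 \<noteq> 0"
proof
  assume "coeff dt 2 = 0"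
  then have "coeff dt i = 0" if "i < 3" for i
    using square_dvd_det that unfolding monom_1_dvd_iff' by (cases "i = 2") auto
  then have "monom 1 3 dvd dt"
    unfolding monom_1_dvd_iff' by blast
  then obtain d' where d': "dt = monom 1 3 * d'" ..
  define v1 where "v1 = tr * fst p - fst (N p)"
  define v2 where "v2 = tr * snd p - snd (N p)"
  have Nv: "A * v1 + B * v2 = dt * fst p" "C * v1 + D * v2 = dt * snd p"
    by (simp_all add: v1_def v2_def pair_op_def algebra_simps)
  define z where "z i = (monom 1 (k - 3 + i) * v1, monom 1 (k - 3 + i) * v2)" for i
  have "pair_dvd (monom 1 k) (N (z i))" for i
  proof -
    have "fst (N (z i)) = monom 1 (k - 3 + i) * (A * v1 + B * v2)"
      "snd (N (z i)) = monom 1 (k - 3 + i) * (C * v1 + D * v2)"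
      by (simp_all add: z_def pair_op_def algebra_simps)
    moreover have "monom 1 (k - 3 + i) * (monom 1 3 * q) = monom 1 k * (monom 1 i * q)" for q :: "'a poly"
      using k by (simp add: mult_monom flip: mult.assoc)
    ultimately show ?thesis
      unfolding Nv d' pair_dvd_def by (simp only: mult.assoc dvd_triv_left simp_thms)
  qed
  then obtain c0 c1 c2 where c: "c0 \<noteq> 0 \<or> c1 \<noteq> 0 \<or> c2 \<noteq> 0"
    "pair_dvd (monom 1 k)
      (Polynomial.smult c0 (fst (z 0)) + Polynomial.smult c1 (fst (z 1)) + Polynomial.smult c2 (fst (z 2)),
       Polynomial.smult c0 (snd (z 0)) + Polynomial.smult c1 (snd (z 1)) + Polynomial.smult c2 (snd (z 2)))"
    using ker by blast
  let ?c = "[:c0, c1, c2:]"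
  have comb: "Polynomial.smult c0 (monom 1 (k - 3 + 0) * v) + Polynomial.smult c1 (monom 1 (k - 3 + 1) * v)
      + Polynomial.smult c2 (monom 1 (k - 3 + 2) * v) = monom 1 (k - 3) * (v * ?c)" for v
  proof -
    have summand: "Polynomial.smult c (monom 1 (k - 3 + i) * v) = monom 1 (k - 3) * (v * monom c i)" for c i
    proof -
      have "Polynomial.smult c (monom 1 (k - 3 + i) * v) = monom c (k - 3 + i) * v"
        by (simp only: mult_smult_left[symmetric] smult_monom) simp
      also have "monom c (k - 3 + i) = monom 1 (k - 3) * monom c i"
        by (simp add: mult_monom)
      finally show ?thesis
        by (simp only: mult_ac)
    qed
    have "?c = monom c0 0 + monom c1 1 + monom c2 2"
      by (simp add: monom_0 monom_Suc numeral_2_eq_2)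
    then show ?thesis
      by (simp only: summand distrib_left)
  qed
  have kk: "k = (k - 3) + 3"
    using k by simp
  have "monom 1 ((k - 3) + 3) dvd monom 1 (k - 3) * (v1 * ?c)"
    "monom 1 ((k - 3) + 3) dvd monom 1 (k - 3) * (v2 * ?c)"
    using c(2) unfolding pair_dvd_def z_def fst_conv snd_conv comb kk[symmetric] by blast+
  then have dvd: "monom 1 3 dvd v1 * ?c" "monom 1 3 dvd v2 * ?c"
    by (simp_all only: monom_Suc_dvd_mult_monom)
  have "poly v1 0 \<noteq> 0 \<or> poly v2 0 \<noteq> 0"
    using p trace_root by (auto simp: pair_dvd_def monom_1_dvd_iff_root v1_def v2_def)
  then have "monom 1 3 dvd ?c"
    using dvd monom_dvd_mult_cancel by blast
  then have "coeff ?c i = 0" if "i < 3" for i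
    using that unfolding monom_1_dvd_iff' by blast
  from this[of 0] this[of 1] this[of 2] have "c0 = 0 \<and> c1 = 0 \<and> c2 = 0"
    by (simp add: numeral_2_eq_2)
  then show False
    using c(1) by simp
qed

end

end

subsection \<open>The criterion for commuting\<close>

lemma exists_linear_relation:
  fixes x y :: "nat \<Rightarrow> 'a::field"
  shows "\<exists>c0 c1 c2. (c0 \<noteq> 0 \<or> c1 \<noteq> 0 \<or> c2 \<noteq> 0) \<and>
    c0 * x 0 + c1 * x 1 + c2 * x 2 = 0 \<and> c0 * y 0 + c1 * y 1 + c2 * y 2 = 0"
proof (cases "x 1 * y 2 - x 2 * y 1 \<noteq> 0 \<or> x 2 * y 0 - x 0 * y 2 \<noteq> 0 \<or> x 0 * y 1 - x 1 * y 0 \<noteq> 0")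
  case True
  then show ?thesis
    by (intro exI[of _ "x 1 * y 2 - x 2 * y 1"] exI[of _ "x 2 * y 0 - x 0 * y 2"]
        exI[of _ "x 0 * y 1 - x 1 * y 0"] conjI) (assumption | simp add: algebra_simps)+
next
  case False
  consider "x 0 = 0" "y 0 = 0" | "x 0 \<noteq> 0" | "y 0 \<noteq> 0"
    by blast
  then show ?thesis
  proof cases
    case 1
    then show ?thesis
      by (intro exI[of _ 1] exI[of _ 0]) simp
  next
    case 2
    then show ?thesis
      using False by (intro exI[of _ "x 1"] exI[of _ "- x 0"] exI[of _ 0]) (simp add: algebra_simps)
  next
    case 3
    then show ?thesis
      using False by (intro exI[of _ "y 1"] exI[of _ "- y 0"] exI[of _ 0]) (simp add: algebra_simps)
  qed
qed

lemma similar_mat_wit_intertwine: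
  assumes "A \<in> carrier_mat n n" "similar_mat_wit A B P Q"
  shows "A * P = P * B" "Q * A = B * Q"
proof -
  note sim = similar_mat_witD2[OF assms]
  have PBQ: "P * B \<in> carrier_mat n n" "B * Q \<in> carrier_mat n n"
    using sim by auto
  have "A * P = P * B * (Q * P)"
    using assoc_mult_mat[OF PBQ(1) sim(7,6)] sim(3) by simp
  then show "A * P = P * B"
    unfolding sim(2) right_mult_one_mat[OF PBQ(1)] .
  have "A = P * (B * Q)"
    using assoc_mult_mat[OF sim(6,5,7)] sim(3) by simp
  then have "Q * A = (Q * P) * (B * Q)"
    using assoc_mult_mat[OF sim(7,6) PBQ(2)] by simp
  then show "Q * A = B * Q"
    unfolding sim(2) left_mult_one_mat[OF PBQ(2)] .
qed

lemma commuting_mat_is_pair_op: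
  fixes Y :: "'a::field mat"
  assumes Yc: "Y \<in> carrier_mat (k + k) (k + k)" and comm: "Y * jordan2 k k = jordan2 k k * Y"
    and AC: "Y *\<^sub>v pair_vec k k 1 0 = pair_vec k k A C"
    and BD: "Y *\<^sub>v pair_vec k k 0 1 = pair_vec k k B D"
  shows "Y *\<^sub>v pair_vec k k f g = pair_vec k k (A * f + B * g) (C * f + D * g)"
proof -
  let ?J = "jordan2 k k :: 'a mat"
  have step: "Y *\<^sub>v pair_vec k k (monom 1 1 * f) (monom 1 1 * g) = ?J *\<^sub>v (Y *\<^sub>v pair_vec k k f g)" for f g
    unfolding jordan2_mult_pair_vec[symmetric]
    by (simp only: comm assoc_mult_mat_vec[OF Yc jordan2_carrier pair_vec_carrier, symmetric]
        assoc_mult_mat_vec[OF jordan2_carrier Yc pair_vec_carrier])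
  have lin: "Y *\<^sub>v pair_vec k k (Polynomial.smult c f + f') (Polynomial.smult c g + g')
      = c \<cdot>\<^sub>v (Y *\<^sub>v pair_vec k k f g) + Y *\<^sub>v pair_vec k k f' g'" for c f g f' g'
    by (simp only: pair_vec_add[symmetric] pair_vec_smult[symmetric] smult_carrier_vec pair_vec_carrier
        mult_add_distrib_mat_vec[OF Yc] mult_mat_vec[OF Yc pair_vec_carrier])
  have pCons_eq: "pCons c p = Polynomial.smult c 1 + monom 1 1 * p" for c :: 'a and p
    by (simp add: monom_Suc monom_0 one_pCons)
  have 1: "Y *\<^sub>v pair_vec k k f 0 = pair_vec k k (A * f) (C * f)" for f
  proof (induction f)
    case 0
    then show ?case
      using Yc by auto
  next
    case (pCons c p)
    have "Y *\<^sub>v pair_vec k k (pCons c p) 0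
        = Y *\<^sub>v pair_vec k k (Polynomial.smult c 1 + monom 1 1 * p) (Polynomial.smult c 0 + monom 1 1 * 0)"
      by (simp only: pCons_eq[of c p] smult_0_right mult_zero_right add_0_left)
    also have "\<dots> = pair_vec k k (A * pCons c p) (C * pCons c p)"
      unfolding lin step AC pCons.IH jordan2_mult_pair_vec pair_vec_smult pair_vec_add pCons_eq[of c p]
      by (simp add: algebra_simps)
    finally show ?case .
  qed
  have 2: "Y *\<^sub>v pair_vec k k 0 f = pair_vec k k (B * f) (D * f)" for f
  proof (induction f)
    case 0
    then show ?case
      using Yc by auto
  next
    case (pCons c p)
    have "Y *\<^sub>v pair_vec k k 0 (pCons c p)
        = Y *\<^sub>v pair_vec k k (Polynomial.smult c 0 + monom 1 1 * 0) (Polynomial.smult c 1 + monom 1 1 * p)"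
      by (simp only: pCons_eq[of c p] smult_0_right mult_zero_right add_0_left)
    also have "\<dots> = pair_vec k k (B * pCons c p) (D * pCons c p)"
      unfolding lin step BD pCons.IH jordan2_mult_pair_vec pair_vec_smult pair_vec_add pCons_eq[of c p]
      by (simp add: algebra_simps)
    finally show ?case .
  qed
  show ?thesis
    using lin[of 1 f 0 0 g] by (simp add: 1 2 pair_vec_add)
qed

lemma lucas_of_similar_jordan:
  fixes Y :: "'a::field mat"
  assumes K: "is_subfield K" and Y: "Y \<in> mats_over K (k + k)" and k: "k \<ge> 3"
    and comm: "Y * jordan2 k k = jordan2 k k * Y"
    and sim: "similar_mat_wit Y (jordan2 (k + 1) (k - 1)) R S"
  shows "\<exists>t\<in>K. \<exists>d\<in>K. d \<noteq> 0 \<and> lucas t d k \<noteq> 0"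
proof -
  let ?n = "k + k"
  let ?J = "jordan2 (k + 1) (k - 1) :: 'a mat"
  have n: "(k + 1) + (k - 1) = ?n"
    using k by simp
  have K0: "0 \<in> K" "1 \<in> K" "\<And>x y. x \<in> K \<Longrightarrow> y \<in> K \<Longrightarrow> x + y \<in> K \<and> x * y \<in> K"
    using K by (auto simp: is_subfield_def)
  have Yc: "Y \<in> carrier_mat ?n ?n"
    using Y by (simp add: mats_over_iff)
  note sim' = similar_mat_witD2[OF Yc sim]
  have Rc: "R \<in> carrier_mat ?n ?n" and Sc: "S \<in> carrier_mat ?n ?n" and Jc: "?J \<in> carrier_mat ?n ?n"
    using sim' by simp_all
  have YR: "Y * R = R * ?J" and SY: "S * Y = ?J * S"
    by (rule similar_mat_wit_intertwine[OF Yc sim])+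
  have RS: "R *\<^sub>v (S *\<^sub>v v) = v" if "v \<in> carrier_vec ?n" for v
    using that Rc Sc sim'(1) by (simp flip: assoc_mult_mat_vec)
  have SR: "S *\<^sub>v (R *\<^sub>v v) = v" if "v \<in> carrier_vec ?n" for v
    using that Rc Sc sim'(2) by (simp flip: assoc_mult_mat_vec)
  have R0: "R *\<^sub>v 0\<^sub>v ?n = 0\<^sub>v ?n" and S0: "S *\<^sub>v 0\<^sub>v ?n = 0\<^sub>v ?n"
    using Rc Sc by auto

  have col_in_K: "(Y *\<^sub>v v) $ i \<in> K" if "v \<in> carrier_vec ?n" "\<And>j. j < ?n \<Longrightarrow> v $ j \<in> K" "i < ?n" for v i
  proof -
    have "(\<Sum>j<?n. Y $$ (i, j) * v $ j) \<in> K"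
      using Y that K0 by (intro subfield_sum[OF K]) (auto simp: mats_over_iff)
    then show ?thesis
      using that Yc by (simp add: scalar_prod_def atLeast0LessThan)
  qed
  have obt: "\<exists>f g. Y *\<^sub>v pair_vec k k a b = pair_vec k k f g \<and> (\<forall>i. coeff f i \<in> K) \<and> (\<forall>i. coeff g i \<in> K)"
    if "\<And>i. coeff a i \<in> K" "\<And>i. coeff b i \<in> K" for a b
  proof -
    let ?v = "Y *\<^sub>v pair_vec k k a b"
    have v: "?v \<in> carrier_vec ?n"
      by (rule mult_mat_vec_carrier[OF Yc pair_vec_carrier])
    obtain f g where fg: "?v = pair_vec k k f g" "\<And>i. coeff f i \<in> insert 0 (vec_index ?v ` {..<?n})"
      "\<And>i. coeff g i \<in> insert 0 (vec_index ?v ` {..<?n})"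
      using pair_vec_surj[OF v] by metis
    have "insert 0 (vec_index ?v ` {..<?n}) \<subseteq> K"
      using col_in_K[OF pair_vec_carrier pair_vec_index_in] that K0(1) by auto
    then show ?thesis
      using fg by blast
  qed
  have coeff01: "coeff 1 i \<in> K" "coeff 0 i \<in> K" for i
    using K0 by (simp_all add: coeff_1)
  obtain A C where AC: "Y *\<^sub>v pair_vec k k 1 0 = pair_vec k k A C" "\<And>i. coeff A i \<in> K" "\<And>i. coeff C i \<in> K"
    using obt[OF coeff01] by blast
  obtain B D where BD: "Y *\<^sub>v pair_vec k k 0 1 = pair_vec k k B D" "\<And>i. coeff B i \<in> K" "\<And>i. coeff D i \<in> K"
    using obt[OF coeff01(2,1)] by blast
  let ?N = "pair_op A B C D"
  let ?v = "\<lambda>p. pair_vec k k (fst p) (snd p)"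
  have Y_mult: "Y *\<^sub>v ?v p = ?v (?N p)" for p
    using commuting_mat_is_pair_op[OF Yc comm AC(1) BD(1)] by (simp add: pair_op_def)
  have Y_pow: "((*\<^sub>v) Y ^^ m) (?v p) = ?v ((?N ^^ m) p)" for m p
    by (induction m) (simp_all add: Y_mult)
  have v0: "?v p = 0\<^sub>v ?n \<longleftrightarrow> pair_dvd (monom 1 k) p" for p
    by (simp add: pair_vec_eq_0_iff pair_dvd_def monom_1_dvd_iff')
  have powR: "((*\<^sub>v) Y ^^ m) (R *\<^sub>v v) = R *\<^sub>v (((*\<^sub>v) ?J ^^ m) v)" if "v \<in> carrier_vec ?n" for m v
    by (rule funpow_intertwine[OF Yc Jc Rc YR that])

  have nilp: "pair_dvd (monom 1 k) ((?N ^^ Suc k) p)" for p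
  proof -
    have Sv: "S *\<^sub>v ?v p \<in> carrier_vec ?n"
      by (rule mult_mat_vec_carrier[OF Sc pair_vec_carrier])
    then obtain f g where fg: "S *\<^sub>v ?v p = pair_vec (k + 1) (k - 1) f g"
      using pair_vec_surj[of _ "k + 1" "k - 1"] unfolding n by metis
    have "((*\<^sub>v) Y ^^ Suc k) (?v p) = R *\<^sub>v (((*\<^sub>v) ?J ^^ Suc k) (S *\<^sub>v ?v p))"
      using powR[OF Sv] RS[OF pair_vec_carrier] by metis
    also have "((*\<^sub>v) ?J ^^ Suc k) (S *\<^sub>v ?v p) = 0\<^sub>v ?n"
      unfolding fg jordan2_funpow_pair_vec n[symmetric] pair_vec_eq_0_iff
      by (auto simp: coeff_monom_mult)
    finally show ?thesis
      unfolding Y_pow R0 v0 .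
  qed

  obtain p where p: "\<not> pair_dvd (monom 1 k) ((?N ^^ k) p)"
  proof -
    let ?w = "pair_vec (k + 1) (k - 1) 1 0 :: 'a vec"
    have w: "?w \<in> carrier_vec ?n"
      using pair_vec_carrier[of "k + 1" "k - 1"] unfolding n .
    have "R *\<^sub>v ?w \<in> carrier_vec ?n"
      by (rule mult_mat_vec_carrier[OF Rc w])
    then obtain f g where fg: "R *\<^sub>v ?w = pair_vec k k f g"
      using pair_vec_surj by metis
    have "((*\<^sub>v) ?J ^^ k) ?w = pair_vec (k + 1) (k - 1) (monom 1 k) 0"
      by (simp add: jordan2_funpow_pair_vec)
    moreover have "\<dots> \<noteq> 0\<^sub>v ?n"
      unfolding n[symmetric] pair_vec_eq_0_iff by (auto intro!: exI[of _ k])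
    ultimately have "((*\<^sub>v) ?J ^^ k) ?w \<noteq> 0\<^sub>v ?n"
      by simp
    moreover have "((*\<^sub>v) ?J ^^ k) ?w \<in> carrier_vec ?n"
      using Jc w by (rule funpow_mult_mat_vec_carrier)
    ultimately have "R *\<^sub>v (((*\<^sub>v) ?J ^^ k) ?w) \<noteq> 0\<^sub>v ?n"
      using SR S0 by metis
    then have "((*\<^sub>v) Y ^^ k) (?v (f, g)) \<noteq> 0\<^sub>v ?n"
      using powR[OF w, of k] fg by simp
    then show thesis
      using that unfolding Y_pow v0 by blast
  qed
  have ker: "\<exists>c0 c1 c2. (c0 \<noteq> 0 \<or> c1 \<noteq> 0 \<or> c2 \<noteq> 0) \<and>
        pair_dvd (monom 1 k)
          (Polynomial.smult c0 (fst z0) + Polynomial.smult c1 (fst z1) + Polynomial.smult c2 (fst z2),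
           Polynomial.smult c0 (snd z0) + Polynomial.smult c1 (snd z1) + Polynomial.smult c2 (snd z2))"
    if z: "pair_dvd (monom 1 k) (?N z0)" "pair_dvd (monom 1 k) (?N z1)" "pair_dvd (monom 1 k) (?N z2)"
    for z0 z1 z2
  proof -
    define y where "y i = S *\<^sub>v ?v ([z0, z1, z2] ! i)" for i
    have yc: "y i \<in> carrier_vec ?n" for i
      unfolding y_def by (rule mult_mat_vec_carrier[OF Sc pair_vec_carrier])
    have y0: "y i $ j = 0" if "i < 3" "j < ?n" "j \<noteq> 0" "j \<noteq> k + 1" for i j
    proof (rule jordan2_kernel_index[of _ "k + 1" "k - 1", unfolded n])
      let ?z = "[z0, z1, z2] ! i"
      have "pair_dvd (monom 1 k) (?N ?z)"
        using z that(1) by (auto simp: less_Suc_eq numeral_3_eq_3)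
      then have "Y *\<^sub>v ?v ?z = 0\<^sub>v ?n"
        by (simp only: Y_mult v0)
      then have "S *\<^sub>v (Y *\<^sub>v ?v ?z) = 0\<^sub>v ?n"
        using S0 by simp
      then show "?J *\<^sub>v y i = 0\<^sub>v ?n"
        by (simp only: y_def assoc_mult_mat_vec[OF Sc Yc pair_vec_carrier, symmetric] SY
            assoc_mult_mat_vec[OF Jc Sc pair_vec_carrier])
    qed (use yc that in auto)
    obtain c0 c1 c2 where c: "c0 \<noteq> 0 \<or> c1 \<noteq> 0 \<or> c2 \<noteq> 0"
      "c0 * y 0 $ 0 + c1 * y 1 $ 0 + c2 * y 2 $ 0 = 0"
      "c0 * y 0 $ (k + 1) + c1 * y 1 $ (k + 1) + c2 * y 2 $ (k + 1) = 0"
      using exists_linear_relation[of "\<lambda>i. y i $ 0" "\<lambda>i. y i $ (k + 1)"] by blast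
    let ?z = "(Polynomial.smult c0 (fst z0) + Polynomial.smult c1 (fst z1) + Polynomial.smult c2 (fst z2),
      Polynomial.smult c0 (snd z0) + Polynomial.smult c1 (snd z1) + Polynomial.smult c2 (snd z2))"
    have z_eq: "?v ?z = c0 \<cdot>\<^sub>v ?v z0 + c1 \<cdot>\<^sub>v ?v z1 + c2 \<cdot>\<^sub>v ?v z2"
      by (simp add: pair_vec_add pair_vec_smult)
    have "S *\<^sub>v ?v ?z = c0 \<cdot>\<^sub>v y 0 + c1 \<cdot>\<^sub>v y 1 + c2 \<cdot>\<^sub>v y 2"
      unfolding z_eq
      by (simp add: mult_add_distrib_mat_vec[OF Sc] mult_mat_vec[OF Sc pair_vec_carrier] y_def numeral_2_eq_2)
    also have "\<dots> = 0\<^sub>v ?n"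
    proof (rule eq_vecI)
      fix j assume "j < dim_vec (0\<^sub>v ?n :: 'a vec)"
      then have j: "j < ?n"
        by simp
      have "(c0 \<cdot>\<^sub>v y 0 + c1 \<cdot>\<^sub>v y 1 + c2 \<cdot>\<^sub>v y 2) $ j = c0 * y 0 $ j + c1 * y 1 $ j + c2 * y 2 $ j"
        using j yc[of 0] yc[of 1] yc[of 2] by (simp add: carrier_vecD)
      also have "\<dots> = 0"
        using c(2,3) y0[of 0 j] y0[of 1 j] y0[of 2 j] j by (cases "j = 0"; cases "j = k + 1") simp_all
      finally show "(c0 \<cdot>\<^sub>v y 0 + c1 \<cdot>\<^sub>v y 1 + c2 \<cdot>\<^sub>v y 2) $ j = 0\<^sub>v ?n $ j"
        using j by simp
    qed (use yc[of 2] in \<open>simp add: carrier_vecD\<close>)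
    finally have "?v ?z = 0\<^sub>v ?n"
      using RS[OF pair_vec_carrier] R0 by metis
    then show ?thesis
      using c(1) unfolding v0 by blast
  qed

  let ?t = "coeff (A + D) 1"
  let ?d = "coeff (A * D - B * C) 2"
  note pN = lucas_nonzero_of_funpow[OF k nilp p]
  have "?d \<noteq> 0"
    using det_coeff_nonzero[OF k nilp pN(2) ker] .
  moreover have "?t \<in> K"
    using AC BD K0 by simp
  moreover have "?d \<in> K"
    using AC BD K0 unfolding coeff_diff coeff_mult
    by (intro subfield_diff[OF K] subfield_sum[OF K]) auto
  ultimately show ?thesis
    using pN(1) by blast
qed

lemma lucas_of_nilp_classes_commute:
  fixes K :: "'a::field set"
  assumes K: "is_subfield K" and k: "k \<ge> 3"
    and comm: "nilp_classes_commute K [k, k] [k + 1, k - 1]"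
  shows "\<exists>t\<in>K. \<exists>d\<in>K. d \<noteq> 0 \<and> lucas t d k \<noteq> 0"
proof -
  let ?n = "k + k"
  have n: "sum_list [k, k] = ?n" "sum_list [k + 1, k - 1] = ?n"
    using k by simp_all
  obtain X Y P Q P' Q' where XY: "X * Y = Y * X" "X \<in> mats_over K ?n" "Y \<in> mats_over K ?n"
    "P \<in> mats_over K ?n" "Q \<in> mats_over K ?n" "similar_mat_wit X (jordan2 k k) P Q"
    "similar_mat_wit Y (jordan2 (k + 1) (k - 1)) P' Q'"
    using comm unfolding nilp_classes_commute_def nilp_class_def similar_over_def n by auto
  have c: "X \<in> carrier_mat ?n ?n" "Y \<in> carrier_mat ?n ?n"
    "P \<in> carrier_mat ?n ?n" "Q \<in> carrier_mat ?n ?n"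
    using XY by (simp_all add: mats_over_iff)
  note sim = similar_mat_witD2[OF c(1) XY(6)]
  let ?J = "jordan2 k k :: 'a mat"
  let ?Y = "Q * Y * P"
  have Jc: "?J \<in> carrier_mat ?n ?n"
    using sim by simp
  note assoc = assoc_mult_mat[of _ ?n ?n _ ?n _ ?n]
  have XP: "X * P = P * ?J" and QX: "Q * X = ?J * Q"
    by (rule similar_mat_wit_intertwine[OF c(1) XY(6)])+
  have "?Y * ?J = Q * Y * (P * ?J)"
    using c Jc by (simp add: assoc)
  also have "\<dots> = Q * (Y * X) * P"
    using c Jc by (simp add: assoc flip: XP)
  also have "\<dots> = (Q * X) * Y * P"
    using c by (simp add: assoc flip: XY(1))
  also have "\<dots> = ?J * ?Y"
    using c Jc by (simp add: assoc QX)
  finally have "?Y * ?J = ?J * ?Y" .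
  moreover have "?Y \<in> mats_over K ?n"
    using XY by (intro mats_over_mult[OF K])
  moreover have "similar_mat_wit ?Y Y Q P"
    using c sim by (intro similar_mat_witI[where n = ?n]) auto
  then have "similar_mat_wit ?Y (jordan2 (k + 1) (k - 1)) (Q * P') (Q' * P)"
    using XY(7) by (rule similar_mat_wit_trans)
  ultimately show ?thesis
    using lucas_of_similar_jordan[OF K _ k] by blast
qed

theorem theorem4p8:
  fixes p r :: nat
  assumes "prime p"
    and "CHAR('a::alg_closed_field) = p"
    and "r \<ge> 1"
  shows "\<exists>n l m. partition_of n l \<and> partition_of n m \<and>
    (\<forall>a\<ge>1. (a > r \<longrightarrow> nilp_classes_commute (gal_field a :: 'a set) l m) \<and>
            (a \<le> r \<longrightarrow> \<not> nilp_classes_commute (gal_field a :: 'a set) l m))"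
proof -
  have char: "prime CHAR('a)"
    using assms(1,2) by simp
  have char_power: "CHAR('a) ^ (2 * a) = (p ^ 2) ^ a" for a
    by (simp only: assms(2) power_mult)
  define L where "L = Lcm ((\<lambda>b. (p ^ 2) ^ b - 1) ` {1..r})"
  define k where "k = p * L"
  have p2: "p \<ge> 2"
    using assms(1) by (rule prime_ge_2_nat)
  then have q4: "p ^ 2 \<ge> 4"
    using power_mono[of 2 p 2] by simp
  have pos: "(p ^ 2) ^ b - 1 \<noteq> 0" if "b \<ge> 1" for b
  proof -
    have "p ^ 2 \<le> (p ^ 2) ^ b"
      using that q4 by (intro self_le_power) auto
    then show ?thesis
      using q4 by linarith
  qed
  have "L \<noteq> 0"
    using pos by (auto simp: L_def Lcm_0_iff)
  moreover have dvd_L: "(p ^ 2) ^ b - 1 dvd L" if "1 \<le> b" "b \<le> r" for b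
    unfolding L_def using that by (intro dvd_Lcm) auto
  ultimately have "p ^ 2 - 1 \<le> L"
    using dvd_L[of 1] assms(3) by (intro dvd_imp_le) auto
  then have L3: "L \<ge> 3"
    using q4 by linarith
  have "k \<ge> 2 * 3"
    unfolding k_def using p2 L3 by (intro mult_le_mono)
  then have k: "k \<ge> 3"
    by simp
  have "partition_of (k + k) [k, k]" "partition_of (k + k) [k + 1, k - 1]"
    using k by (auto simp: partition_of_def)
  moreover have "nilp_classes_commute (gal_field a :: 'a set) [k, k] [k + 1, k - 1]" if "a > r" for a
  proof -
    have a: "a \<ge> 1"
      using that by simp
    have "\<exists>t d :: 'a. t \<in> gal_field a \<and> d \<in> gal_field a \<and> d \<noteq> 0 \<and> lucas t d k \<noteq> 0"
    proof (rule ccontr)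
      assume "\<not> ?thesis"
      then have "CHAR('a) ^ (2 * a) - 1 dvd 2 * k"
        using k by (intro dvd_of_lucas_gal_field_eq_0[OF char a]) auto
      then have "(p ^ 2) ^ a - 1 dvd p * (2 * L)"
        by (simp only: char_power k_def mult.left_commute)
      moreover have "coprime ((p ^ 2) ^ a - 1) p"
      proof -
        have "coprime ((p ^ 2) ^ a - 1) ((p ^ 2) ^ a)"
          using p2 by (intro coprime_diff_one_left_nat) auto
        moreover have "p dvd (p ^ 2) ^ a"
          using a by (simp add: power_mult[symmetric])
        ultimately show ?thesis
          by (rule coprime_divisors[OF dvd_refl, rotated])
      qed
      ultimately have "(p ^ 2) ^ a - 1 dvd 2 * L"
        by (simp add: coprime_dvd_mult_right_iff)
      then show False
        using power_minus_one_not_dvd_Lcm[OF q4 that] by (simp add: L_def)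
    qed
    then obtain t d :: 'a where "t \<in> gal_field a" "d \<in> gal_field a" "d \<noteq> 0" "lucas t d k \<noteq> 0"
      by blast
    then show ?thesis
      using k by (intro nilp_classes_commute_of_lucas[OF is_subfield_gal_field[OF char]]) auto
  qed
  moreover have "\<not> nilp_classes_commute (gal_field a :: 'a set) [k, k] [k + 1, k - 1]"
    if "1 \<le> a" "a \<le> r" for a
  proof
    assume "nilp_classes_commute (gal_field a :: 'a set) [k, k] [k + 1, k - 1]"
    then obtain t d :: 'a where td: "t \<in> gal_field a" "d \<in> gal_field a" "d \<noteq> 0" "lucas t d k \<noteq> 0"
      using lucas_of_nilp_classes_commute[OF is_subfield_gal_field[OF char] k] by blast
    have "CHAR('a) dvd k"
      by (simp add: k_def assms(2))
    moreover have "CHAR('a) ^ (2 * a) - 1 dvd k"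
      using dvd_L[OF that] by (simp only: char_power k_def dvd_mult)
    ultimately have "lucas t d k = 0"
      using td k by (intro lucas_gal_field_eq_0[OF char]) auto
    then show False
      using td(4) by contradiction
  qed
  ultimately show ?thesis
    by (intro exI[of _ "k + k"] exI[of _ "[k, k]"] exI[of _ "[k + 1, k - 1]"]) simp
qed

end
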